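(* Let $G$ be a subgroup of $\mathrm{Diff}^1_+([0,1])$ isomorphic to $BS(1,2):=\langle g,h \mid ghg^{-1}=h^2\rangle$, and denote by $g,h$ also the diffeomorphisms corresponding to the generators. Then the centralizer of $G$ inside $\mathrm{Diff}^1_+([0,1])$ is the group of diffeomorphisms having support in the complement of the support of $h$. In particular, if $G$ has no global fixed point in the interior $(0,1)$, then its centralizer is trivial.
   Context: $\mathrm{Diff}^1_+([0,1])$ is the group of orientation-preserving $C^1$ diffeomorphisms of $[0,1]$. The centralizer of $G$ inside $\mathrm{Diff}^1_+([0,1])$ is the group of elements of $\mathrm{Diff}^1_+([0,1])$ commuting with every element of $G$. The support of a diffeomorphism $f$ is the set $\{x\in[0,1] : f(x)\neq x\}$ of points moved by $f$. A global fixed point of $G$ is a point fixed by all elements of $G$.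
   Formalization: The stated equality fails if g moves points fixed by h; proved instead: the centralizer of G is the set of diffeomorphisms commuting with g and supported off the support of h, with the stated equality when the support of g lies in that of h. The final claim is unchanged. *)

theory Defs
  imports "HOL-Analysis.Analysis" "HOL-Algebra.Group" "HOL-Algebra.Bij"
begin

section \<open>Groups given by generators and relations\<close>

text \<open>
  The letter \<open>(a, False)\<close> stands for the generator \<open>a\<close> and \<open>(a, True)\<close> for its formal
  inverse.  A relation \<open>u = v\<close> is given by the pair \<open>(u, v)\<close>.
\<close>

type_synonym 'a word = "('a \<times> bool) list"

inductive pres_eq :: "('a word \<times> 'a word) set \<Rightarrow> 'a word \<Rightarrow> 'a word \<Rightarrow> bool"
  for R where
  refl: "pres_eq R u u"
| sym: "pres_eq R u v \<Longrightarrow> pres_eq R v u"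
| trans: "pres_eq R u v \<Longrightarrow> pres_eq R v w \<Longrightarrow> pres_eq R u w"
| append: "pres_eq R u v \<Longrightarrow> pres_eq R u' v' \<Longrightarrow> pres_eq R (u @ u') (v @ v')"
| cancel: "pres_eq R [(a, e), (a, \<not> e)] []"
| relation: "(u, v) \<in> R \<Longrightarrow> pres_eq R u v"

definition pres_class :: "('a word \<times> 'a word) set \<Rightarrow> 'a word \<Rightarrow> 'a word set" where
  "pres_class R u = {v. pres_eq R u v}"

definition presented_group :: "('a word \<times> 'a word) set \<Rightarrow> 'a word set monoid" where
  "presented_group R =
    \<lparr>carrier = range (pres_class R),
     mult = (\<lambda>A B. \<Union>u\<in>A. \<Union>v\<in>B. pres_class R (u @ v)),
     one = pres_class R []\<rparr>"

lemma mem_pres_class_iff: "v \<in> pres_class R u \<longleftrightarrow> pres_eq R u v"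
  by (simp add: pres_class_def)

lemma pres_class_eq_iff: "pres_class R u = pres_class R v \<longleftrightarrow> pres_eq R u v"
  unfolding pres_class_def set_eq_iff mem_Collect_eq
  using pres_eq.refl pres_eq.sym pres_eq.trans by metis

lemma presented_group_mult:
  "pres_class R u \<otimes>\<^bsub>presented_group R\<^esub> pres_class R v = pres_class R (u @ v)"
proof -
  have "pres_class R (u' @ v') = pres_class R (u @ v)"
    if "u' \<in> pres_class R u" "v' \<in> pres_class R v" for u' v'
    using that unfolding pres_class_eq_iff mem_pres_class_iff
    by (intro pres_eq.append pres_eq.sym[of R u u'] pres_eq.sym[of R v v'])
  moreover have "u \<in> pres_class R u" "v \<in> pres_class R v"
    by (simp_all add: mem_pres_class_iff pres_eq.refl)
  ultimately show ?thesis
    unfolding presented_group_def monoid.simps by blast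
qed

lemma group_presented_group: "group (presented_group R)"
proof (rule groupI)
  have carr: "carrier (presented_group R) = range (pres_class R)"
    by (simp add: presented_group_def)
  fix x y z
  assume "x \<in> carrier (presented_group R)" "y \<in> carrier (presented_group R)"
  then show "x \<otimes>\<^bsub>presented_group R\<^esub> y \<in> carrier (presented_group R)"
    by (auto simp: carr presented_group_mult)
  assume "z \<in> carrier (presented_group R)"
  with \<open>x \<in> _\<close> \<open>y \<in> _\<close>
  show "x \<otimes>\<^bsub>presented_group R\<^esub> y \<otimes>\<^bsub>presented_group R\<^esub> z
      = x \<otimes>\<^bsub>presented_group R\<^esub> (y \<otimes>\<^bsub>presented_group R\<^esub> z)"
    by (auto simp: carr presented_group_mult)
next
  show "\<one>\<^bsub>presented_group R\<^esub> \<in> carrier (presented_group R)"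
    by (simp add: presented_group_def)
next
  fix x assume "x \<in> carrier (presented_group R)"
  then show "\<one>\<^bsub>presented_group R\<^esub> \<otimes>\<^bsub>presented_group R\<^esub> x = x"
    using presented_group_mult[of R "[]"] by (auto simp: presented_group_def)
next
  fix x assume "x \<in> carrier (presented_group R)"
  then obtain u where u: "x = pres_class R u" by (auto simp: presented_group_def)
  have inv: "pres_eq R (rev (map (\<lambda>(a, e). (a, \<not> e)) u) @ u) []" for u
  proof (induction u)
    case Nil
    show ?case by (simp add: pres_eq.refl)
  next
    case (Cons l u)
    obtain a e where l: "l = (a, e)" by force
    let ?i = "rev (map (\<lambda>(a, e). (a, \<not> e)) u)"
    have "pres_eq R [(a, \<not> e), (a, e)] []"
      using pres_eq.cancel[of R a "\<not> e"] by simp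
    then have "pres_eq R (?i @ [(a, \<not> e), (a, e)] @ u) (?i @ [] @ u)"
      by (intro pres_eq.append pres_eq.refl)
    then have "pres_eq R (?i @ [(a, \<not> e), (a, e)] @ u) []"
      by (rule pres_eq.trans) (use Cons.IH in simp)
    then show ?case by (simp add: l)
  qed
  show "\<exists>y\<in>carrier (presented_group R). y \<otimes>\<^bsub>presented_group R\<^esub> x = \<one>\<^bsub>presented_group R\<^esub>"
  proof
    show "pres_class R (rev (map (\<lambda>(a, e). (a, \<not> e)) u)) \<otimes>\<^bsub>presented_group R\<^esub> x
        = \<one>\<^bsub>presented_group R\<^esub>"
      using inv[of u] by (simp add: u presented_group_mult pres_class_eq_iff)
         (simp add: presented_group_def pres_class_eq_iff)
  qed (simp add: presented_group_def)
qed

subsection \<open>The Baumslag--Solitar group \<open>BS(1,2)\<close>\<close>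

datatype bs_gen = Gen_g | Gen_h

definition BS12_relations :: "(bs_gen word \<times> bs_gen word) set" where
  "BS12_relations =
    {([(Gen_g, False), (Gen_h, False), (Gen_g, True)], [(Gen_h, False), (Gen_h, False)])}"

definition BS12 :: "bs_gen word set monoid" where
  "BS12 = presented_group BS12_relations"

definition BS12_gen :: "bs_gen \<Rightarrow> bs_gen word set" where
  "BS12_gen a = pres_class BS12_relations [(a, False)]"

section \<open>The group \<open>Diff\<^sup>1\<^sub>+([0,1])\<close>\<close>

text \<open>
  One-sided derivatives are used at the endpoints.  The library's
  \<open>C1_differentiable_on\<close> asks for two-sided ones, so it would depend on the values outside
  the interval.
\<close>

definition C1_on :: "real set \<Rightarrow> (real \<Rightarrow> real) \<Rightarrow> bool" where
  "C1_on S f \<longleftrightarrow>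
    (\<exists>f'. (\<forall>x\<in>S. (f has_real_derivative f' x) (at x within S)) \<and> continuous_on S f')"

text \<open>
  As in \<open>BijGroup\<close>, a map of \<open>[0,1]\<close> is extended by \<open>undefined\<close> outside the interval, so that
  two diffeomorphisms are equal as soon as they agree on \<open>[0,1]\<close>; the product is composition,
  \<open>(f \<otimes> k) x = f (k x)\<close>.
\<close>

definition Diff1 :: "(real \<Rightarrow> real) monoid" where
  "Diff1 = BijGroup {0..1}
    \<lparr>carrier := {f \<in> Bij {0..1}. strict_mono_on {0..1} f \<and>
        C1_on {0..1} f \<and> C1_on {0..1} (inv_into {0..1} f)}\<rparr>"

lemma C1_on_cong:
  assumes "\<And>x. x \<in> S \<Longrightarrow> f x = k x"
  shows "C1_on S f \<longleftrightarrow> C1_on S k"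
proof -
  have "(f has_real_derivative D) (at x within S) \<longleftrightarrow> (k has_real_derivative D) (at x within S)"
    if "x \<in> S" for x D
    by (rule has_field_derivative_cong_eventually)
       (use assms that in \<open>auto simp: eventually_at_filter\<close>)
  then show ?thesis unfolding C1_on_def by (auto cong: ball_cong)
qed

lemma C1_on_compose:
  assumes f: "C1_on S f" and k: "C1_on S k" and kS: "k ` S \<subseteq> S"
  shows "C1_on S (f \<circ> k)"
proof -
  obtain f' where f': "\<And>x. x \<in> S \<Longrightarrow> (f has_real_derivative f' x) (at x within S)"
    and f'_cont: "continuous_on S f'" using f unfolding C1_on_def by blast
  obtain k' where k': "\<And>x. x \<in> S \<Longrightarrow> (k has_real_derivative k' x) (at x within S)"
    and k'_cont: "continuous_on S k'" using k unfolding C1_on_def by blast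
  have k_cont: "continuous_on S k"
    by (rule DERIV_continuous_on) (use k' in auto)
  have "(f \<circ> k has_real_derivative f' (k x) * k' x) (at x within S)" if "x \<in> S" for x
    by (rule DERIV_image_chain)
       (use that kS f' k' in \<open>auto intro: has_field_derivative_subset\<close>)
  moreover have "continuous_on S (\<lambda>x. f' (k x) * k' x)"
    by (intro continuous_intros k'_cont continuous_on_compose2[OF f'_cont k_cont kS])
  ultimately show ?thesis unfolding C1_on_def by (intro exI conjI ballI)
qed

lemma subgroup_Diff1: "subgroup (carrier Diff1) (BijGroup {0..1})"
proof -
  let ?I = "{0..1::real}"
  interpret B: group "BijGroup ?I" by (rule group_BijGroup)
  have carrD: "carrier Diff1 = {f \<in> Bij ?I. strict_mono_on ?I f \<and> C1_on ?I f \<and>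
      C1_on ?I (inv_into ?I f)}" by (simp add: Diff1_def)
  have mult: "f \<otimes>\<^bsub>BijGroup ?I\<^esub> k = compose ?I f k" if "f \<in> Bij ?I" "k \<in> Bij ?I" for f k
    using that by (simp add: BijGroup_def)
  show ?thesis
  proof (rule B.subgroupI)
    show "carrier Diff1 \<subseteq> carrier (BijGroup ?I)" by (auto simp: carrD BijGroup_def)
    have "C1_on ?I (\<lambda>x. x)" unfolding C1_on_def
      by (rule exI[of _ "\<lambda>_. 1"]) auto
    moreover have "inv_into ?I (\<lambda>x\<in>?I. x) y = y" if "y \<in> ?I" for y
      by (rule inv_into_f_eq) (use that in \<open>auto simp: inj_on_def\<close>)
    ultimately have "(\<lambda>x\<in>?I. x) \<in> carrier Diff1"
      using C1_on_cong[of ?I "\<lambda>x\<in>?I. x" "\<lambda>x. x"]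
        C1_on_cong[of ?I "inv_into ?I (\<lambda>x\<in>?I. x)" "\<lambda>x. x"]
      by (simp add: carrD id_Bij strict_mono_on_def)
    then show "carrier Diff1 \<noteq> {}" by blast
  next
    fix f assume "f \<in> carrier Diff1"
    then have f: "f \<in> Bij ?I" "strict_mono_on ?I f" "C1_on ?I f" "C1_on ?I (inv_into ?I f)"
      by (auto simp: carrD)
    let ?r = "\<lambda>x\<in>?I. inv_into ?I f x"
    have bij: "bij_betw f ?I ?I" using f(1) by (simp add: Bij_def)
    have rB: "?r \<in> Bij ?I" by (rule restrict_inv_into_Bij[OF f(1)])
    have f_inv: "f (inv_into ?I f y) = y" "inv_into ?I f y \<in> ?I" if "y \<in> ?I" for y
      using that bij by (auto simp: bij_betw_def f_inv_into_f inv_into_into simp del: atLeastAtMost_iff)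
    have "inv_into ?I ?r x = f x" if "x \<in> ?I" for x
      by (rule inv_into_f_eq)
         (use that bij rB in \<open>auto simp: Bij_def bij_betw_def inv_into_f_f simp del: atLeastAtMost_iff\<close>)
    moreover have "inv_into ?I f x < inv_into ?I f y" if "x \<in> ?I" "y \<in> ?I" "x < y" for x y
      using strict_mono_on_less[OF f(2) f_inv(2)[OF that(1)] f_inv(2)[OF that(2)]] f_inv(1) that
      by simp
    ultimately have "?r \<in> carrier Diff1"
      using rB f C1_on_cong[of ?I ?r "inv_into ?I f"] C1_on_cong[of ?I "inv_into ?I ?r" f]
      by (simp add: carrD strict_mono_on_def)
    then show "inv\<^bsub>BijGroup ?I\<^esub> f \<in> carrier Diff1"
      by (simp add: inv_BijGroup f(1))
  next
    fix f k assume "f \<in> carrier Diff1" "k \<in> carrier Diff1"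
    then have f: "f \<in> Bij ?I" "strict_mono_on ?I f" "C1_on ?I f" "C1_on ?I (inv_into ?I f)"
      and k: "k \<in> Bij ?I" "strict_mono_on ?I k" "C1_on ?I k" "C1_on ?I (inv_into ?I k)"
      by (auto simp: carrD)
    have bf: "bij_betw f ?I ?I" and bk: "bij_betw k ?I ?I" using f(1) k(1) by (auto simp: Bij_def)
    have cB: "compose ?I f k \<in> Bij ?I" by (rule compose_Bij[OF f(1) k(1)])
    have img: "k ` ?I \<subseteq> ?I" "inv_into ?I f ` ?I \<subseteq> ?I"
      using bk bij_betw_inv_into[OF bf] by (auto simp: bij_betw_def simp del: atLeastAtMost_iff)
    have "inv_into ?I (compose ?I f k) y = (inv_into ?I k \<circ> inv_into ?I f) y" if y: "y \<in> ?I" for y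
    proof (rule inv_into_f_eq)
      show "inj_on (compose ?I f k) ?I" using cB by (auto simp: Bij_def bij_betw_def)
      have 1: "inv_into ?I f y \<in> ?I" using img y by blast
      then show 2: "(inv_into ?I k \<circ> inv_into ?I f) y \<in> ?I"
        using bij_betw_inv_into[OF bk] by (metis bij_betwE comp_apply)
      show "compose ?I f k ((inv_into ?I k \<circ> inv_into ?I f) y) = y"
        using 1 2 y bij_betw_inv_into_right[OF bk 1] bij_betw_inv_into_right[OF bf y]
        by (simp add: compose_def)
    qed
    moreover have "strict_mono_on ?I (compose ?I f k)"
      using f(2) k(2) img by (auto simp: strict_mono_on_def compose_def image_subset_iff)
    ultimately have "compose ?I f k \<in> carrier Diff1"
      using cB C1_on_cong[of ?I "compose ?I f k" "f \<circ> k"]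
        C1_on_cong[of ?I "inv_into ?I (compose ?I f k)" "inv_into ?I k \<circ> inv_into ?I f"]
        C1_on_compose[OF f(3) k(3) img(1)] C1_on_compose[OF k(4) f(4) img(2)]
      by (simp add: carrD compose_def)
    then show "f \<otimes>\<^bsub>BijGroup ?I\<^esub> k \<in> carrier Diff1" by (simp add: mult f k)
  qed
qed

lemma group_Diff1: "group Diff1"
  using group.subgroup_imp_group[OF group_BijGroup subgroup_Diff1]
  by (simp add: Diff1_def)

section \<open>Centralizer and support\<close>

definition centralizer :: "('a, 'b) monoid_scheme \<Rightarrow> 'a set \<Rightarrow> 'a set" where
  "centralizer M A = {f \<in> carrier M. \<forall>k\<in>A. f \<otimes>\<^bsub>M\<^esub> k = k \<otimes>\<^bsub>M\<^esub> f}"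

text \<open>The support is the set of moved points itself; no closure is taken.\<close>

definition supp :: "(real \<Rightarrow> real) \<Rightarrow> real set" where
  "supp f = {x \<in> {0..1}. f x \<noteq> x}"

definition Diff1_supported_in :: "real set \<Rightarrow> (real \<Rightarrow> real) set" where
  "Diff1_supported_in A = {f \<in> carrier Diff1. supp f \<subseteq> A}"

text \<open>
  Pitfall.  For \<open>G = \<langle>g, h\<rangle> \<cong> BS(1,2)\<close> the equation
  \<open>centralizer Diff1 G = Diff1_supported_in ({0..1} - supp h)\<close> can fail when \<open>g\<close> moves
  points that \<open>h\<close> fixes.  Example: in the coordinate \<open>t\<close> identifying \<open>(0,1/2)\<close> with the real
  line by \<open>t = 1 / (1/2 - x) - 1 / x\<close>, let \<open>g\<close> and \<open>h\<close> be \<open>t \<mapsto> 2 t\<close> and \<open>t \<mapsto> t + 1\<close>; these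
  extend to \<open>C\<^sup>1\<close> diffeomorphisms of \<open>[0,1/2]\<close> with \<open>g' = 1/2\<close> and \<open>h' = 1\<close> at both endpoints.
  On \<open>[1/2,1]\<close> let \<open>h\<close> be the identity and \<open>g\<close> any \<open>C\<^sup>1\<close> diffeomorphism with \<open>g' = 1/2\<close> at
  \<open>1/2\<close> and no fixed point inside; a diffeomorphism with support a small interval in
  \<open>(1/2,1)\<close> then does not commute with \<open>g\<close>.  Accordingly, the elements supported in the
  complement of \<open>supp h\<close> have to be taken inside the centralizer of \<open>g\<close> (they always commute
  with \<open>h\<close>); this condition is automatic when \<open>supp g \<subseteq> supp h\<close>.
\<close>

end

theory Submission
  imports Defs
begin

text \<open>
  The relation forces \<open>h' = 1\<close> at every common fixed point of \<open>g\<close> and \<open>h\<close>, so \<open>h\<close> distorts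
  lengths there by factors arbitrarily close to 1, while \<open>g h g\<^sup>-\<^sup>1 = h\<^sup>2\<close> doubles the number of
  \<open>h\<close>-steps at each application of \<open>g\<close>.  This exponential count is incompatible with bounded total
  length in two situations.  First, \<open>g\<close> cannot move a component of the support of \<open>h\<close>; since
  \<open>g f\<close> and \<open>h\<close> satisfy the same relation when \<open>f\<close> centralizes them, \<open>f\<close> preserves each
  component as well.  Second, \<open>f\<close> cannot move a point inside such a component.
\<close>

section \<open>Diffeomorphisms of the interval\<close>

lemma Diff1_carrier_iff:
  "f \<in> carrier Diff1 \<longleftrightarrow>
    f \<in> Bij {0..1} \<and> strict_mono_on {0..1} f \<and> C1_on {0..1} f \<and> C1_on {0..1} (inv_into {0..1} f)"
  by (simp add: Diff1_def)

lemma Diff1_mult_apply: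
  assumes "f \<in> carrier Diff1" "k \<in> carrier Diff1" "x \<in> {0..1}"
  shows "(f \<otimes>\<^bsub>Diff1\<^esub> k) x = f (k x)"
proof -
  have "f \<otimes>\<^bsub>Diff1\<^esub> k = compose {0..1} f k"
    using assms by (simp add: Diff1_def BijGroup_def)
  then show ?thesis using assms(3) by (simp add: compose_def)
qed

lemma Diff1_one_apply: "x \<in> {0..1} \<Longrightarrow> \<one>\<^bsub>Diff1\<^esub> x = x"
  by (simp add: Diff1_def BijGroup_def)

lemma Diff1_eqI:
  assumes "f \<in> carrier Diff1" "k \<in> carrier Diff1" "\<And>x. x \<in> {0..1} \<Longrightarrow> f x = k x"
  shows "f = k"
proof (rule extensionalityI)
  show "f \<in> extensional {0..1}" "k \<in> extensional {0..1}"
    using assms(1,2) by (auto simp: Diff1_carrier_iff Bij_imp_extensional)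
qed (use assms(3) in auto)

lemma Diff1_mem:
  assumes "f \<in> carrier Diff1" "x \<in> {0..1}"
  shows "f x \<in> {0..1}"
  using assms Bij_imp_funcset[of f "{0..1}"] by (auto simp: Diff1_carrier_iff)

lemma Diff1_less_iff:
  assumes "f \<in> carrier Diff1" "x \<in> {0..1}" "y \<in> {0..1}"
  shows "f x < f y \<longleftrightarrow> x < y"
  using assms strict_mono_on_less[of "{0..1}" f x y] by (simp add: Diff1_carrier_iff)

lemma Diff1_le_iff:
  assumes "f \<in> carrier Diff1" "x \<in> {0..1}" "y \<in> {0..1}"
  shows "f x \<le> f y \<longleftrightarrow> x \<le> y"
  using Diff1_less_iff[OF assms(1,3,2)] by (simp add: not_less[symmetric])

lemma Diff1_eq_iff:
  assumes "f \<in> carrier Diff1" "x \<in> {0..1}" "y \<in> {0..1}"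
  shows "f x = f y \<longleftrightarrow> x = y"
  using Diff1_le_iff[OF assms] Diff1_le_iff[OF assms(1,3,2)] by (simp add: order_eq_iff)

lemma Diff1_inv_closed: "f \<in> carrier Diff1 \<Longrightarrow> inv\<^bsub>Diff1\<^esub> f \<in> carrier Diff1"
  by (rule group.inv_closed[OF group_Diff1])

lemma Diff1_inv_apply:
  assumes "f \<in> carrier Diff1" "x \<in> {0..1}"
  shows "f ((inv\<^bsub>Diff1\<^esub> f) x) = x" "(inv\<^bsub>Diff1\<^esub> f) (f x) = x"
  using Diff1_mult_apply[OF assms(1) Diff1_inv_closed[OF assms(1)] assms(2)]
    Diff1_mult_apply[OF Diff1_inv_closed[OF assms(1)] assms]
    group.r_inv[OF group_Diff1 assms(1)] group.l_inv[OF group_Diff1 assms(1)]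
    Diff1_one_apply[OF assms(2)] by simp_all

lemma Diff1_endpoints:
  assumes "f \<in> carrier Diff1"
  shows "f 0 = 0" "f 1 = 1"
proof -
  let ?k = "inv\<^bsub>Diff1\<^esub> f"
  have "f 0 \<le> f (?k 0)" "f (?k 1) \<le> f 1"
    using Diff1_mem[OF Diff1_inv_closed[OF assms], of 0] Diff1_mem[OF Diff1_inv_closed[OF assms], of 1]
    by (simp_all add: Diff1_le_iff[OF assms])
  then show "f 0 = 0" "f 1 = 1"
    using Diff1_mem[OF assms, of 0] Diff1_mem[OF assms, of 1] by (simp_all add: Diff1_inv_apply[OF assms])
qed

section \<open>One-sided derivatives and linear approximation\<close>

lemma at_within_unit_interval_nontrivial:
  fixes x :: real
  assumes "x \<in> {0..1}"
  shows "at x within {0..1} \<noteq> bot"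
  using assms islimpt_Icc[of 0 1 x] by (simp add: trivial_limit_within)

text \<open>The derivative cannot vanish because the inverse is differentiable too: by the chain
  rule the two derivatives multiply to 1. Monotonicity then decides the sign.\<close>

lemma Diff1_obtain_derivative:
  assumes f: "f \<in> carrier Diff1"
  obtains f' where "\<And>x. x \<in> {0..1} \<Longrightarrow> (f has_real_derivative f' x) (at x within {0..1})"
    "\<And>x. x \<in> {0..1} \<Longrightarrow> f' x > 0" "continuous_on {0..1} f'"
proof -
  let ?k = "inv\<^bsub>Diff1\<^esub> f"
  have k: "?k \<in> carrier Diff1" by (rule Diff1_inv_closed[OF f])
  obtain f' where f': "\<And>x. x \<in> {0..1} \<Longrightarrow> (f has_real_derivative f' x) (at x within {0..1})"
    and cont: "continuous_on {0..1} f'" using f unfolding Diff1_carrier_iff C1_on_def by blast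
  obtain k' where k': "\<And>x. x \<in> {0..1} \<Longrightarrow> (?k has_real_derivative k' x) (at x within {0..1})"
    using k unfolding Diff1_carrier_iff C1_on_def by blast
  have "f' x > 0" if x: "x \<in> {0..1}" for x
  proof -
    have fimg: "f ` {0..1} \<subseteq> {0..1}" using Diff1_mem[OF f] by blast
    have "(?k \<circ> f has_real_derivative k' (f x) * f' x) (at x within {0..1})"
      by (rule DERIV_image_chain)
        (use x f' k' fimg Diff1_mem[OF f x] in \<open>auto intro: has_field_derivative_subset\<close>)
    moreover have "(?k \<circ> f has_real_derivative 1) (at x within {0..1})"
    proof (subst has_field_derivative_cong_eventually)
      show "\<forall>\<^sub>F y in at x within {0..1}. (?k \<circ> f) y = y"
        by (auto simp: eventually_at_filter Diff1_inv_apply[OF f])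
      show "(?k \<circ> f) x = x" using x by (simp add: Diff1_inv_apply[OF f])
    qed auto
    ultimately have "k' (f x) * f' x = 1"
      using has_field_derivative_unique at_within_unit_interval_nontrivial[OF x] by blast
    moreover have "f' x \<ge> 0"
    proof (rule tendsto_lowerbound)
      show "((\<lambda>y. (f y - f x) / (y - x)) \<longlongrightarrow> f' x) (at x within {0..1})"
        using f'[OF x] by (simp add: has_field_derivative_iff)
      show "\<forall>\<^sub>F y in at x within {0..1}. 0 \<le> (f y - f x) / (y - x)"
        using x Diff1_le_iff[OF f] by (auto simp: eventually_at_filter zero_le_divide_iff linear)
    qed (use at_within_unit_interval_nontrivial[OF x] in auto)
    ultimately show ?thesis by (metis less_eq_real_def mult_zero_right zero_neq_one)
  qed
  with f' cont that show thesis by blast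
qed

lemma Diff1_continuous_on: "f \<in> carrier Diff1 \<Longrightarrow> continuous_on {0..1} f"
  by (metis DERIV_continuous_on Diff1_obtain_derivative)

lemma Diff1_tendsto:
  assumes "f \<in> carrier Diff1" "s \<longlonglongrightarrow> r" "\<And>n. s n \<in> {0..1}" "r \<in> {0..1}"
  shows "(\<lambda>n. f (s n)) \<longlonglongrightarrow> f r"
  by (rule continuous_on_tendsto_compose[OF Diff1_continuous_on[OF assms(1)] assms(2,4)])
     (use assms(3) in auto)

text \<open>The mean value theorem turns closeness of the continuous derivative to \<open>l\<close>
  into two-sided bounds for increments. The factor \<open>c\<close> stands on the left of the upper
  bound to avoid a division.\<close>

lemma Diff1_near_linear:
  assumes f: "f \<in> carrier Diff1" and r: "r \<in> {0..1}"
    and l: "(f has_real_derivative l) (at r within {0..1})" and c: "0 < c" "c < 1"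
  obtains \<delta> where "\<delta> > 0"
    "\<And>x z. \<lbrakk>x \<in> {0..1}; z \<in> {0..1}; \<bar>x - r\<bar> < \<delta>; \<bar>z - r\<bar> < \<delta>; x \<le> z\<rbrakk> \<Longrightarrow>
      c * l * (z - x) \<le> f z - f x \<and> c * (f z - f x) \<le> l * (z - x)"
proof -
  obtain f' where f': "\<And>x. x \<in> {0..1} \<Longrightarrow> (f has_real_derivative f' x) (at x within {0..1})"
    and pos: "\<And>x. x \<in> {0..1} \<Longrightarrow> f' x > 0" and cont: "continuous_on {0..1} f'"
    using Diff1_obtain_derivative[OF f] by metis
  have fr: "f' r = l"
    using f'[OF r] l at_within_unit_interval_nontrivial[OF r] has_field_derivative_unique by blast
  then have "l > 0" using pos[OF r] by simp
  have "(f' \<longlongrightarrow> l) (at r within {0..1})"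
    using cont r fr by (auto simp: continuous_on)
  moreover have "c * l < l" "l < l / c" using c \<open>l > 0\<close> by (simp_all add: field_simps)
  ultimately have "\<forall>\<^sub>F x in at r within {0..1}. c * l < f' x \<and> f' x < l / c"
    by (intro eventually_conj order_tendstoD)
  then obtain \<delta> where "\<delta> > 0" and
    \<delta>0: "\<And>x. \<lbrakk>x \<in> {0..1}; x \<noteq> r; dist x r < \<delta>\<rbrakk> \<Longrightarrow> c * l < f' x \<and> f' x < l / c"
    by (auto simp: eventually_at)
  \<comment> \<open>The filter leaves out \<open>r\<close> itself; this point is added through
    \<open>f' r = l\<close>.\<close>
  have \<delta>: "c * l \<le> f' x \<and> c * f' x \<le> l" if "x \<in> {0..1}" "\<bar>x - r\<bar> < \<delta>" for x
  proof (cases "x = r")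
    case True
    then show ?thesis using fr \<open>c * l < l\<close> by simp
  next
    case False
    with that \<delta>0[of x] c show ?thesis by (auto simp: dist_real_def field_simps)
  qed
  show thesis
  proof (rule that[OF \<open>\<delta> > 0\<close>])
    fix x z assume xz: "x \<in> {0..1}" "z \<in> {0..1}" "\<bar>x - r\<bar> < \<delta>" "\<bar>z - r\<bar> < \<delta>" "x \<le> z"
    have "\<exists>w\<in>{x..z}. f z - f x = (\<lambda>t. f' w * t) (z - x)"
    proof (rule mvt_very_simple[OF \<open>x \<le> z\<close>])
      fix w assume "x \<le> w" "w \<le> z"
      with xz show "(f has_derivative (*) (f' w)) (at w within {x..z})"
        by (intro has_field_derivative_imp_has_derivative has_field_derivative_subset[OF f']) auto
    qed
    then obtain w where w: "w \<in> {x..z}" "f z - f x = f' w * (z - x)" by auto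
    have "c * l \<le> f' w \<and> c * f' w \<le> l" by (rule \<delta>) (use xz w in auto)
    then have "c * l * (z - x) \<le> f' w * (z - x)" "(c * f' w) * (z - x) \<le> l * (z - x)"
      using \<open>x \<le> z\<close> by (auto intro: mult_right_mono)
    then show "c * l * (z - x) \<le> f z - f x \<and> c * (f z - f x) \<le> l * (z - x)"
      by (simp add: w(2) mult.assoc)
  qed
qed

section \<open>Iterates of a diffeomorphism\<close>

lemma Diff1_funpow_mem:
  assumes "f \<in> carrier Diff1" "x \<in> {0..1}"
  shows "(f ^^ n) x \<in> {0..1}"
proof (induction n)
  case (Suc n)
  then show ?case using Diff1_mem[OF assms(1) Suc] by simp
qed (use assms in simp)

lemma Diff1_funpow_less_iff:
  assumes "f \<in> carrier Diff1" "x \<in> {0..1}" "y \<in> {0..1}"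
  shows "(f ^^ n) x < (f ^^ n) y \<longleftrightarrow> x < y"
proof (induction n)
  case (Suc n)
  then show ?case
    using Diff1_less_iff[OF assms(1) Diff1_funpow_mem[OF assms(1,2), of n]
      Diff1_funpow_mem[OF assms(1,3), of n]] by simp
qed simp

lemma Diff1_funpow_le_iff:
  assumes "f \<in> carrier Diff1" "x \<in> {0..1}" "y \<in> {0..1}"
  shows "(f ^^ n) x \<le> (f ^^ n) y \<longleftrightarrow> x \<le> y"
  using Diff1_funpow_less_iff[OF assms(1,3,2)] by (simp add: not_less[symmetric])

lemma Diff1_funpow_commute:
  assumes f: "f \<in> carrier Diff1" and k: "k \<in> carrier Diff1"
    and "\<And>x. x \<in> {0..1} \<Longrightarrow> f (k x) = k (f x)" and "x \<in> {0..1}"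
  shows "f ((k ^^ n) x) = (k ^^ n) (f x)"
proof (induction n)
  case (Suc n)
  then show ?case using assms(3)[OF Diff1_funpow_mem[OF k assms(4), of n]] by simp
qed simp

section \<open>Components of the support of h\<close>

text \<open>The relation of \<open>BS12\<close> without inverses, so that it can be evaluated at
  points. Besides the images of the generators, \<open>g\<close> with the inverse of
  \<open>h\<close>, and the product of \<open>g\<close> and a commuting \<open>f\<close> with
  \<open>h\<close>, become instances.\<close>

locale BS12_pair =
  fixes g h :: "real \<Rightarrow> real"
  assumes g: "g \<in> carrier Diff1" and h: "h \<in> carrier Diff1"
    and rel: "\<And>x. x \<in> {0..1} \<Longrightarrow> g (h x) = h (h (g x))"
begin

text \<open>Passing to the inverse of \<open>h\<close> reduces points moved to the left to points
  moved to the right.\<close>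

lemma inv_h: "BS12_pair g (inv\<^bsub>Diff1\<^esub> h)"
proof
  let ?k = "inv\<^bsub>Diff1\<^esub> h"
  show k: "?k \<in> carrier Diff1" by (rule Diff1_inv_closed[OF h])
  fix x :: real assume x: "x \<in> {0..1}"
  have kx: "?k x \<in> {0..1}" by (rule Diff1_mem[OF k x])
  note gkx = Diff1_mem[OF g kx]
  have "g x = h (h (g (?k x)))" using rel[OF kx] by (simp add: Diff1_inv_apply[OF h x])
  then show "g (?k x) = ?k (?k (g x))"
    by (simp add: Diff1_inv_apply(2)[OF h Diff1_mem[OF h gkx]] Diff1_inv_apply(2)[OF h gkx])
qed (rule g)

lemma g_funpow_h: "x \<in> {0..1} \<Longrightarrow> g ((h ^^ n) x) = (h ^^ (2 * n)) (g x)"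
proof (induction n)
  case (Suc n)
  then show ?case using rel[OF Diff1_funpow_mem[OF h Suc.prems, of n]] by simp
qed simp

lemma funpow_g_h: "x \<in> {0..1} \<Longrightarrow> (g ^^ n) (h x) = (h ^^ (2 ^ n)) ((g ^^ n) x)"
proof (induction n)
  case (Suc n)
  then show ?case using g_funpow_h[OF Diff1_funpow_mem[OF g Suc.prems, of n], of "2 ^ n"] by simp
qed simp

text \<open>\<open>g\<close> conjugates \<open>h\<close> to its square, and an increasing map has
  the same fixed points as its square. Hence \<open>g\<close> permutes the components of the support
  of \<open>h\<close>.\<close>

lemma fixed_h_g_iff:
  assumes x: "x \<in> {0..1}"
  shows "h (g x) = g x \<longleftrightarrow> h x = x"
proof
  assume "h (g x) = g x"
  then have "g (h x) = g x" using rel[OF x] by simp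
  then show "h x = x" using Diff1_eq_iff[OF g Diff1_mem[OF h x] x] by simp
next
  note gx = Diff1_mem[OF g x]
  assume "h x = x"
  then have *: "h (h (g x)) = g x" using rel[OF x] by simp
  show "h (g x) = g x"
    using Diff1_less_iff[OF h gx Diff1_mem[OF h gx]] Diff1_less_iff[OF h Diff1_mem[OF h gx] gx] *
    by linarith
qed

text \<open>At a common fixed point the relation forces \<open>h' = h' * h'\<close>.  Any constant \<open>c < 1\<close> with
  \<open>c\<^sup>2 (1 + c) > 1\<close> could replace \<open>9/10\<close>.\<close>

lemma near_common_fixed_point:
  assumes r: "r \<in> {0..1}" "g r = r" "h r = r"
  obtains l \<delta> where "l > 0" "\<delta> > 0"
    "\<And>x z. \<lbrakk>x \<in> {0..1}; z \<in> {0..1}; \<bar>x - r\<bar> < \<delta>; \<bar>z - r\<bar> < \<delta>; x \<le> z\<rbrakk> \<Longrightarrow>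
      9/10 * l * (z - x) \<le> g z - g x \<and> 9/10 * (g z - g x) \<le> l * (z - x) \<and> 9/10 * (z - x) \<le> h z - h x"
proof -
  obtain l where l: "(g has_real_derivative l) (at r within {0..1})" "l > 0"
    using Diff1_obtain_derivative[OF g] r(1) by metis
  obtain m where m: "(h has_real_derivative m) (at r within {0..1})" "m > 0"
    using Diff1_obtain_derivative[OF h] r(1) by metis
  have img: "g ` {0..1} \<subseteq> {0..1}" "h ` {0..1} \<subseteq> {0..1}"
    using Diff1_mem[OF g] Diff1_mem[OF h] by blast+
  have gl: "(g has_real_derivative l) (at (h r) within h ` {0..1})"
    and hm: "(h has_real_derivative m) (at (g r) within g ` {0..1})"
    using l(1) m(1) img r by (simp_all add: has_field_derivative_subset)
  have hhm: "(h has_real_derivative m) (at ((h \<circ> g) r) within (h \<circ> g) ` {0..1})"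
    by (rule has_field_derivative_subset[of _ _ _ "{0..1}"])
       (use m(1) r img in \<open>auto simp: image_comp[symmetric]\<close>)
  have "(g \<circ> h has_real_derivative l * m) (at r within {0..1})"
    by (rule DERIV_image_chain[OF gl m(1)])
  moreover have "(h \<circ> (h \<circ> g) has_real_derivative m * (m * l)) (at r within {0..1})"
    by (rule DERIV_image_chain[OF hhm DERIV_image_chain[OF hm l(1)]])
  moreover have "(h \<circ> (h \<circ> g) has_real_derivative D) (at r within {0..1}) \<longleftrightarrow>
      (g \<circ> h has_real_derivative D) (at r within {0..1})" for D
    by (rule has_field_derivative_cong_eventually)
       (use rel r in \<open>auto simp: eventually_at_filter\<close>)
  ultimately have "l * m = m * (m * l)"
    using has_field_derivative_unique at_within_unit_interval_nontrivial[OF r(1)] by blast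
  then have "m = 1" using l m by simp
  obtain \<delta>1 where \<delta>1: "\<delta>1 > 0" "\<And>x z. \<lbrakk>x \<in> {0..1}; z \<in> {0..1}; \<bar>x - r\<bar> < \<delta>1; \<bar>z - r\<bar> < \<delta>1; x \<le> z\<rbrakk> \<Longrightarrow>
      9/10 * l * (z - x) \<le> g z - g x \<and> 9/10 * (g z - g x) \<le> l * (z - x)"
    using Diff1_near_linear[OF g r(1) l(1), of "9/10"] by auto
  obtain \<delta>2 where \<delta>2: "\<delta>2 > 0" "\<And>x z. \<lbrakk>x \<in> {0..1}; z \<in> {0..1}; \<bar>x - r\<bar> < \<delta>2; \<bar>z - r\<bar> < \<delta>2; x \<le> z\<rbrakk> \<Longrightarrow>
      9/10 * m * (z - x) \<le> h z - h x \<and> 9/10 * (h z - h x) \<le> m * (z - x)"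
    using Diff1_near_linear[OF h r(1) m(1), of "9/10"] by auto
  show thesis
    by (rule that[of l "min \<delta>1 \<delta>2"]) (use l(2) \<delta>1 \<delta>2 \<open>m = 1\<close> in auto)
qed

text \<open>If \<open>g\<close> moved the component \<open>(a, b)\<close> of the support of \<open>h\<close>, then the disjoint intervals
  \<open>g\<^sup>-\<^sup>n (a, b)\<close> would shrink to a common fixed point of \<open>g\<close> and \<open>h\<close>.  There the relation makes the
  displacement of \<open>h\<close> at \<open>g\<^sup>-\<^sup>n y\<close>, relative to the length of \<open>g\<^sup>-\<^sup>n (a, b)\<close>, grow geometrically.\<close>

lemma g_fixes_component_aux:
  assumes ab: "a \<in> {0..1}" "b \<in> {0..1}" "h a = a" "h b = b"
    and nofix: "\<And>x. a < x \<Longrightarrow> x < b \<Longrightarrow> h x \<noteq> x"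
    and y: "a < y" "y < b" "h y > y"
  shows "g a = a"
proof (rule ccontr)
  assume ga: "g a \<noteq> a"
  define G where "G = inv\<^bsub>Diff1\<^esub> g"
  have G: "G \<in> carrier Diff1" unfolding G_def by (rule Diff1_inv_closed[OF g])
  have gG: "g (G x) = x" "G (g x) = x" if "x \<in> {0..1}" for x
    using Diff1_inv_apply[OF g that] by (simp_all add: G_def)
  have y01: "y \<in> {0..1}" using ab y by auto
  define A B Y where "A = (\<lambda>n. (G ^^ n) a)" and "B = (\<lambda>n. (G ^^ n) b)" and "Y = (\<lambda>n. (G ^^ n) y)"
  have mem: "A n \<in> {0..1}" "B n \<in> {0..1}" "Y n \<in> {0..1}" for n
    unfolding A_def B_def Y_def using Diff1_funpow_mem[OF G] ab y01 by blast+
  have AYB: "A n < Y n" "Y n < B n" for n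
    using Diff1_funpow_less_iff[OF G] ab(1,2) y y01 by (simp_all add: A_def B_def Y_def)
  have step: "g (A (Suc n)) = A n" "g (B (Suc n)) = B n" "g (Y (Suc n)) = Y n" for n
    using gG(1)[OF mem(1)] gG(1)[OF mem(2)] gG(1)[OF mem(3)] by (simp_all add: A_def B_def Y_def)
  have AB_fixed: "h (A n) = A n \<and> h (B n) = B n" for n
  proof (induction n)
    case (Suc n)
    then show ?case
      using fixed_h_g_iff[OF mem(1), of "Suc n"] fixed_h_g_iff[OF mem(2), of "Suc n"] by (simp add: step)
  qed (use ab in \<open>simp add: A_def B_def\<close>)
  have "\<exists>r. A \<longlonglongrightarrow> r \<and> B \<longlonglongrightarrow> r"
  proof (cases "g a > a")
    case True
    \<comment> \<open>The point \<open>g a\<close> is fixed by \<open>h\<close>, so it cannot lie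
      strictly between \<open>a\<close> and \<open>b\<close>. The intervals from \<open>A n\<close>
      to \<open>B n\<close> therefore line up without overlap, and \<open>B (Suc n)\<close> is
      squeezed between \<open>A (Suc n)\<close> and \<open>A n\<close>.\<close>
    have "g a \<ge> b" using nofix[of "g a"] True fixed_h_g_iff[OF ab(1)] ab(3) by force
    then have "G b \<le> a"
      using Diff1_le_iff[OF G ab(2) Diff1_mem[OF g ab(1)]] gG(2)[OF ab(1)] by simp
    then have BA: "B (Suc n) \<le> A n" for n
      using Diff1_funpow_le_iff[OF G Diff1_mem[OF G ab(2)] ab(1)]
      by (simp add: A_def B_def funpow_swap1)
    then have "decseq A" by (intro decseq_SucI) (meson AYB less_imp_le less_trans less_le_trans)
    then obtain r where r: "A \<longlonglongrightarrow> r" using decseq_convergent[of A 0] mem(1) by (metis atLeastAtMost_iff)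
    have "(\<lambda>n. B (Suc n)) \<longlonglongrightarrow> r"
      by (rule tendsto_sandwich[OF _ _ LIMSEQ_Suc[OF r] r])
         (use BA AYB in \<open>auto intro!: always_eventually less_imp_le[OF less_trans]\<close>)
    with r show ?thesis using LIMSEQ_imp_Suc by blast
  next
    case False
    then have "g a < a" using ga by simp
    then have "G a > a"
      using Diff1_less_iff[OF G Diff1_mem[OF g ab(1)] ab(1)] gG(2)[OF ab(1)] by simp
    moreover have "h (G a) = G a" using AB_fixed[of 1] by (simp add: A_def)
    ultimately have "G a \<ge> b" using nofix[of "G a"] by force
    then have BA: "A (Suc n) \<ge> B n" for n
      using Diff1_funpow_le_iff[OF G ab(2) Diff1_mem[OF G ab(1)]]
      by (simp add: A_def B_def funpow_swap1)
    then have "incseq A" by (intro incseq_SucI) (meson AYB less_imp_le less_trans less_le_trans)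
    then obtain r where r: "A \<longlonglongrightarrow> r" using incseq_convergent[of A 1] mem(1) by (metis atLeastAtMost_iff)
    have "B \<longlonglongrightarrow> r"
      by (rule tendsto_sandwich[OF _ _ r LIMSEQ_Suc[OF r]])
         (use BA AYB in \<open>auto intro!: always_eventually less_imp_le[OF less_trans]\<close>)
    with r show ?thesis by blast
  qed
  then obtain r where Ar: "A \<longlonglongrightarrow> r" and Br: "B \<longlonglongrightarrow> r" by blast
  have r: "r \<in> {0..1}"
    by (rule closed_sequentially[OF closed_atLeastAtMost _ Ar]) (use mem in auto)
  have "(\<lambda>n. g (A (Suc n))) \<longlonglongrightarrow> g r"
    by (rule Diff1_tendsto[OF g LIMSEQ_Suc[OF Ar] mem(1) r])
  then have gr: "g r = r" using Ar LIMSEQ_unique by (simp add: step)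
  have "(\<lambda>n. h (A n)) \<longlonglongrightarrow> h r" by (rule Diff1_tendsto[OF h Ar mem(1) r])
  then have hr: "h r = r" using Ar LIMSEQ_unique AB_fixed by simp
  obtain l \<delta> where "l > 0" "\<delta> > 0"
    and bounds: "\<And>x z. \<lbrakk>x \<in> {0..1}; z \<in> {0..1}; \<bar>x - r\<bar> < \<delta>; \<bar>z - r\<bar> < \<delta>; x \<le> z\<rbrakk> \<Longrightarrow>
      9/10 * l * (z - x) \<le> g z - g x \<and> 9/10 * (g z - g x) \<le> l * (z - x) \<and> 9/10 * (z - x) \<le> h z - h x"
    using near_common_fixed_point[OF r gr hr] by blast
  have "\<forall>\<^sub>F n in sequentially. dist (A n) r < \<delta> \<and> dist (B n) r < \<delta>"
    by (intro eventually_conj tendstoD Ar Br \<open>\<delta> > 0\<close>)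
  then obtain N where N: "\<And>n. n \<ge> N \<Longrightarrow> \<bar>A n - r\<bar> < \<delta> \<and> \<bar>B n - r\<bar> < \<delta>"
    by (auto simp: eventually_sequentially dist_real_def)
  have hY: "Y n < h (Y n)" "h (Y n) < B n" for n
  proof -
    show "h (Y n) < B n"
      using Diff1_less_iff[OF h mem(3) mem(2), of n n] AYB(2)[of n] AB_fixed[of n] by simp
    \<comment> \<open>Going back along the orbit keeps the sign: \<open>g\<close> maps
      \<open>Y (Suc n)\<close> and \<open>h (Y (Suc n))\<close> to \<open>Y n\<close> and
      \<open>h (h (Y n))\<close>.\<close>
    show "Y n < h (Y n)"
    proof (induction n)
      case (Suc n)
      have "h (h (Y n)) > Y n"
        using Suc Diff1_less_iff[OF h mem(3) Diff1_mem[OF h mem(3)], of n n] by linarith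
      then have "g (Y (Suc n)) < g (h (Y (Suc n)))"
        using rel[OF mem(3), of "Suc n"] by (simp add: step)
      then show ?case using Diff1_less_iff[OF g mem(3) Diff1_mem[OF h mem(3)]] by simp
    qed (use y in \<open>simp add: Y_def\<close>)
  qed
  define d where "d = (\<lambda>n. h (Y n) - Y n)"
  define w where "w = (\<lambda>n. B n - A n)"
  have pos: "d n > 0" "w n > 0" "d n \<le> w n" for n
    using hY[of n] AYB[of n] by (auto simp: d_def w_def)
  \<comment> \<open>By the relation, \<open>g\<close> stretches the step of \<open>h\<close> at
    \<open>Y (Suc n)\<close> onto two consecutive steps from \<open>Y n\<close>. These have total
    length at least \<open>(1 + 9/10) * d n\<close>; the estimate for \<open>g\<close> costs another
    factor \<open>9/10\<close>, and \<open>9/10 * 19/10 = 171/100\<close>.\<close>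
  have d_step: "171/100 * d n \<le> l * d (Suc n)" if "n \<ge> N" for n
  proof -
    have near: "\<bar>Y k - r\<bar> < \<delta>" "\<bar>h (Y k) - r\<bar> < \<delta>" if "k \<ge> N" for k
      using N[OF that] AYB[of k] hY[of k] by auto
    have "9/10 * (h (Y n) - Y n) \<le> h (h (Y n)) - h (Y n)"
      using bounds[OF mem(3) Diff1_mem[OF h mem(3)] near[OF that]] hY(1)[of n] by simp
    moreover have "9/10 * (g (h (Y (Suc n))) - g (Y (Suc n))) \<le> l * (h (Y (Suc n)) - Y (Suc n))"
      using bounds[OF mem(3) Diff1_mem[OF h mem(3)] near] that hY(1)[of "Suc n"] by simp
    ultimately show ?thesis
      using rel[OF mem(3), of "Suc n"] by (simp add: step d_def)
  qed
  have w_step: "9/10 * l * w (Suc n) \<le> w n" if "n \<ge> N" for n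
    using bounds[OF mem(1,2), of "Suc n" "Suc n"] N[of "Suc n"] that AYB[of "Suc n"]
    by (simp add: step w_def)
  \<comment> \<open>The quotient of \<open>d\<close> by \<open>w\<close> grows at each step by at
    least \<open>171/100 * 9/10\<close>, which exceeds \<open>3/2\<close>. It is written without
    denominators.\<close>
  have growth: "(3/2) ^ k * (d N * w (N + k)) \<le> w N * d (N + k)" for k
  proof (induction k)
    case (Suc k)
    let ?n = "N + k"
    have prod_nonneg: "0 \<le> (3/2) ^ k * (d N * w ?n)"
      using pos(1)[of N] pos(2)[of ?n] by simp
    have "(3/2) ^ Suc k * (d N * w (N + Suc k)) * l = 3/2 * (3/2) ^ k * d N * (l * w (Suc ?n))"
      by simp
    also have "\<dots> \<le> 3/2 * (3/2) ^ k * d N * (10/9 * w ?n)"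
      using w_step[of ?n] pos(1)[of N] by (intro mult_left_mono) auto
    also have "\<dots> = 5/3 * ((3/2) ^ k * (d N * w ?n))" by simp
    also have "\<dots> \<le> 171/100 * (w N * d ?n)"
      using Suc prod_nonneg by linarith
    also have "\<dots> = w N * (171/100 * d ?n)" by simp
    also have "\<dots> \<le> w N * (l * d (Suc ?n))"
      using d_step[of ?n] pos(2)[of N] by (intro mult_left_mono) auto
    finally have "l * ((3/2) ^ Suc k * (d N * w (N + Suc k))) \<le> l * (w N * d (N + Suc k))"
      by (simp add: algebra_simps)
    then show ?case using \<open>l > 0\<close> by simp
  qed simp
  \<comment> \<open>For this \<open>k\<close> the quotient of \<open>d\<close> by \<open>w\<close>
    at \<open>N + k\<close> would exceed 1, although a displacement inside the interval is at most
    its length.\<close>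
  obtain k where k: "w N / d N < (3/2) ^ k" using real_arch_pow[of "3/2"] by auto
  have "w N * w (N + k) < (3/2) ^ k * (d N * w (N + k))"
    using k pos(1)[of N] pos(2)[of "N + k"] by (simp add: field_simps)
  also have "\<dots> \<le> w N * d (N + k)" by (rule growth)
  also have "\<dots> \<le> w N * w (N + k)" using pos(2,3) by (intro mult_left_mono) (auto intro: less_imp_le)
  finally show False by simp
qed

text \<open>The sign of the displacement at the midpoint decides whether the previous lemma is
  applied to \<open>h\<close> or to its inverse. The right endpoint then follows from the left one
  by order alone.\<close>

lemma g_fixes_component:
  assumes ab: "a < b" "a \<in> {0..1}" "b \<in> {0..1}" "h a = a" "h b = b"
    and nofix: "\<And>x. a < x \<Longrightarrow> x < b \<Longrightarrow> h x \<noteq> x"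
  shows "g a = a" "g b = b"
proof -
  let ?k = "inv\<^bsub>Diff1\<^esub> h"
  interpret k: BS12_pair g ?k by (rule inv_h)
  define y where "y = (a + b) / 2"
  have y: "a < y" "y < b" using ab by (auto simp: y_def)
  then have y01: "y \<in> {0..1}" using ab by auto
  have k_fix: "?k x = x \<longleftrightarrow> h x = x" if "x \<in> {0..1}" for x
    using Diff1_inv_apply[OF h that] by metis
  show ga: "g a = a"
  proof (cases "h y > y")
    case True
    show ?thesis by (rule g_fixes_component_aux[OF ab(2-) nofix y True])
  next
    case False
    then have "h y < y" using nofix[OF y] by simp
    then have "?k y > y"
      using Diff1_less_iff[OF h y01 Diff1_mem[OF k.h y01]] by (simp add: Diff1_inv_apply[OF h y01])
    then show ?thesis
      by (intro k.g_fixes_component_aux[OF ab(2,3) _ _ _ y]) (use k_fix ab nofix in auto)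
  qed
  let ?G = "inv\<^bsub>Diff1\<^esub> g"
  have Gb: "?G b \<in> {0..1}" by (rule Diff1_mem[OF Diff1_inv_closed[OF g] ab(3)])
  have gGb: "g (?G b) = b" by (rule Diff1_inv_apply(1)[OF g ab(3)])
  \<comment> \<open>Both \<open>g b\<close> and its counterpart under the inverse of
    \<open>g\<close> are fixed by \<open>h\<close> and exceed \<open>a\<close>, so both are at least
    \<open>b\<close>. The two inequalities together force \<open>g b = b\<close>.\<close>
  have "g b > a" using Diff1_less_iff[OF g ab(2,3)] ab(1) ga by simp
  moreover have "h (g b) = g b" using fixed_h_g_iff[OF ab(3)] ab(5) by simp
  ultimately have "g b \<ge> b" using nofix[of "g b"] by force
  moreover have "?G b > a" using Diff1_less_iff[OF g ab(2) Gb] ab(1) ga gGb by simp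
  moreover have "h (?G b) = ?G b" using fixed_h_g_iff[OF Gb] ab(5) gGb by simp
  ultimately have "?G b \<ge> b" using nofix[of "?G b"] by force
  then have "b \<ge> g b" using Diff1_le_iff[OF g ab(3) Gb] gGb by simp
  with \<open>g b \<ge> b\<close> show "g b = b" by simp
qed

end

section \<open>Diffeomorphisms commuting with g and h\<close>

text \<open>The endpoints are the last fixed point before \<open>x\<close> and the first one after
  it; they exist by compactness, since 0 and 1 are fixed.\<close>

lemma Diff1_component:
  assumes h: "h \<in> carrier Diff1" and x: "x \<in> {0..1}" and moved: "h x \<noteq> x"
  obtains a b where "a \<in> {0..1}" "b \<in> {0..1}" "h a = a" "h b = b" "a < x" "x < b"
    "\<And>z. a < z \<Longrightarrow> z < b \<Longrightarrow> h z \<noteq> z"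
proof -
  define F where "F = {z \<in> {0..1}. h z - z = 0}"
  have "continuous_on {0..1} (\<lambda>z. h z - z)"
    by (intro continuous_intros Diff1_continuous_on[OF h])
  then have "closed F" unfolding F_def by (intro continuous_closed_preimage_constant) auto
  then have "compact (F \<inter> {0..x})" "compact (F \<inter> {x..1})" by (auto intro: closed_Int_compact)
  moreover have "0 \<in> F \<inter> {0..x}" "1 \<in> F \<inter> {x..1}"
    using Diff1_endpoints[OF h] x by (auto simp: F_def)
  ultimately obtain a b where a: "a \<in> F \<inter> {0..x}" "\<And>t. t \<in> F \<inter> {0..x} \<Longrightarrow> t \<le> a"
    and b: "b \<in> F \<inter> {x..1}" "\<And>t. t \<in> F \<inter> {x..1} \<Longrightarrow> b \<le> t"
    using compact_attains_sup[of "F \<inter> {0..x}"] compact_attains_inf[of "F \<inter> {x..1}"] by blast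
  show thesis
  proof (rule that[of a b])
    show "a < x" "x < b" using a b moved by (auto simp: F_def less_le)
    show "h z \<noteq> z" if z: "a < z" "z < b" for z
    proof
      assume "h z = z"
      with z a(1) b(1) have "z \<in> F" "0 \<le> z" "z \<le> 1" by (auto simp: F_def)
      then show False using z a(2)[of z] b(2)[of z] by (cases "z \<le> x") auto
    qed
  qed (use a b in \<open>auto simp: F_def\<close>)
qed

text \<open>By the intermediate value theorem, a change of sign of the displacement would create a
  fixed point inside.\<close>

lemma Diff1_positive_on_component:
  assumes h: "h \<in> carrier Diff1" and ab: "a \<in> {0..1}" "b \<in> {0..1}"
    and nofix: "\<And>z. a < z \<Longrightarrow> z < b \<Longrightarrow> h z \<noteq> z"
    and x: "a < x" "x < b" "h x > x" and z: "a < z" "z < b"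
  shows "h z > z"
proof (rule ccontr)
  assume "\<not> h z > z"
  then have le: "h z - z \<le> 0" by simp
  have cont: "continuous_on {s..t} (\<lambda>z. h z - z)" if "0 \<le> s" "t \<le> 1" for s t
    using that by (intro continuous_intros continuous_on_subset[OF Diff1_continuous_on[OF h]]) auto
  have "\<exists>w. a < w \<and> w < b \<and> h w - w = 0"
  proof (cases "z \<le> x")
    case True
    obtain w where "z \<le> w" "w \<le> x" "h w - w = 0" using IVT'[OF le _ True cont] ab x z by auto
    then show ?thesis using x z by (intro exI[of _ w]) auto
  next
    case False
    then obtain w where "x \<le> w" "w \<le> z" "h w - w = 0"
      using IVT2'[OF le _ _ cont, of x] ab x z by auto
    then show ?thesis using x z by (intro exI[of _ w]) auto
  qed
  then show False using nofix by force
qed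

context BS12_pair
begin

text \<open>Near \<open>b\<close> the displacement of \<open>f\<close>, summed over the \<open>2\<^sup>n\<close> points \<open>h\<^sup>j (g\<^sup>n z)\<close> with
  \<open>j < 2\<^sup>n\<close>, grows like \<open>(2 g'(b))\<^sup>n\<close>.  Since \<open>f\<close> lies below \<open>h\<close>, the sum telescopes to at
  most \<open>g\<^sup>n (h z) - g\<^sup>n z\<close>, which only grows like \<open>g'(b)\<^sup>n\<close>.\<close>

lemma commuting_le_id_on_component:
  assumes f: "f \<in> carrier Diff1"
    and fg: "\<And>x. x \<in> {0..1} \<Longrightarrow> f (g x) = g (f x)"
    and fh: "\<And>x. x \<in> {0..1} \<Longrightarrow> f (h x) = h (f x)"
    and ab: "a \<in> {0..1}" "b \<in> {0..1}" "h a = a" "h b = b"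
    and ab_f: "f a = a" "f b = b" and ab_g: "g a = a" "g b = b"
    and pos: "\<And>x. a < x \<Longrightarrow> x < b \<Longrightarrow> h x > x"
    and y: "a < y" "y < b"
  shows "f y \<le> y"
proof (rule ccontr)
  assume "\<not> f y \<le> y"
  then have fy: "f y > y" by simp
  define C where "C = {a<..<b}"
  have C01: "x \<in> {0..1}" if "x \<in> C" for x using that ab by (auto simp: C_def)
  have Cmap: "k x \<in> C" if "k \<in> carrier Diff1" "k a = a" "k b = b" "x \<in> C" for k x
    using Diff1_less_iff[OF that(1) ab(1) C01[OF that(4)]] Diff1_less_iff[OF that(1) C01[OF that(4)] ab(2)]
      that by (auto simp: C_def)
  have hC: "h x \<in> C" and gC: "g x \<in> C" and fC: "f x \<in> C" if "x \<in> C" for x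
    using Cmap that f g h ab ab_f ab_g by blast+
  have yC: "y \<in> C" using y by (simp add: C_def)
  have HC: "(h ^^ n) x \<in> C" if "x \<in> C" for x n by (induction n) (use that hC in auto)
  have GC: "(g ^^ n) x \<in> C" if "x \<in> C" for x n by (induction n) (use that gC in auto)
  have Hstep: "(h ^^ n) x < (h ^^ Suc n) x" if "x \<in> C" for x n
    using pos[of "(h ^^ n) x"] HC[OF that, of n] by (simp add: C_def)
  have Hmono: "(h ^^ m) x \<le> (h ^^ n) x" if "x \<in> C" "m \<le> n" for x m n
    using lift_Suc_mono_le[of "\<lambda>n. (h ^^ n) x" m n] Hstep[OF that(1)] that(2) by (simp add: less_imp_le)
  have Hle: "(h ^^ n) x \<le> (h ^^ n) z \<longleftrightarrow> x \<le> z" if "x \<in> C" "z \<in> C" for n x z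
    by (rule Diff1_funpow_le_iff[OF h C01[OF that(1)] C01[OF that(2)]])
  have Hless: "(h ^^ n) x < (h ^^ n) z \<longleftrightarrow> x < z" if "x \<in> C" "z \<in> C" for n x z
    by (rule Diff1_funpow_less_iff[OF h C01[OF that(1)] C01[OF that(2)]])
  have Hadd: "(h ^^ m) ((h ^^ n) x) = (h ^^ (m + n)) x" for m n x
    by (simp add: funpow_add)
  have fH: "f ((h ^^ n) x) = (h ^^ n) (f x)" if "x \<in> C" for n x
    by (rule Diff1_funpow_commute[OF f h fh C01[OF that]])

  \<comment> \<open>A bounded \<open>h\<close>-orbit would converge to a fixed point of
    \<open>h\<close> inside the component.\<close>
  have escape: "\<exists>n. w < (h ^^ n) z" if z: "z \<in> C" and w: "w \<in> C" for z w
  proof (rule ccontr)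
    assume "\<nexists>n. w < (h ^^ n) z"
    then have bound: "(h ^^ n) z \<le> w" for n by (simp add: not_less)
    have "incseq (\<lambda>n. (h ^^ n) z)" using Hmono[OF z] by (simp add: incseq_def)
    then obtain r where r: "(\<lambda>n. (h ^^ n) z) \<longlonglongrightarrow> r" "\<And>n. (h ^^ n) z \<le> r"
      using incseq_convergent[of "\<lambda>n. (h ^^ n) z" w] bound by metis
    have "r \<le> w" by (rule LIMSEQ_le_const2[OF r(1)]) (use bound in auto)
    then have rC: "r \<in> C" using r(2)[of 0] z w by (auto simp: C_def)
    have "(\<lambda>n. h ((h ^^ n) z)) \<longlonglongrightarrow> h r"
      by (rule Diff1_tendsto[OF h r(1) C01[OF HC[OF z]] C01[OF rC]])
    then have "h r = r" using LIMSEQ_Suc[OF r(1)] LIMSEQ_unique by simp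
    with pos[of r] rC show False by (simp add: C_def)
  qed
  have fundamental: "\<exists>k. (h ^^ k) z \<le> w \<and> w < (h ^^ Suc k) z"
    if zw: "z \<in> C" "w \<in> C" "z \<le> w" for z w
  proof -
    obtain n where "w < (h ^^ n) z" using escape[OF zw(1,2)] by blast
    then obtain k where "\<forall>i\<le>k. \<not> w < (h ^^ i) z" "w < (h ^^ Suc k) z"
      using ex_least_nat_less[of "\<lambda>n. w < (h ^^ n) z" n] zw(3) by auto
    then show ?thesis by (metis not_less order_refl)
  qed

  \<comment> \<open>If \<open>f\<close> moved \<open>z\<close> at least one \<open>h\<close>-step,
    then conjugation by \<open>g^n\<close> would make it move \<open>g^n z\<close> at least
    \<open>2^n\<close> of them. But \<open>f\<close> commutes with \<open>h\<close>, so a bound of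
    \<open>m\<close> steps at \<open>z\<close> gives a bound of \<open>m + 1\<close> steps on the
    whole component.\<close>
  have f_less_h: "f z < h z" if z: "z \<in> C" for z
  proof (rule ccontr)
    assume "\<not> f z < h z"
    then have fz: "h z \<le> f z" by simp
    obtain m where m: "f z < (h ^^ m) z" using escape[OF z fC[OF z]] by blast
    have bound: "f w < (h ^^ Suc m) w" if w: "w \<in> C" for w
    proof (cases "z \<le> w")
      case True
      obtain k where k: "(h ^^ k) z \<le> w" "w < (h ^^ Suc k) z" using fundamental[OF z w True] by blast
      have "f w < f ((h ^^ Suc k) z)"
        using Diff1_less_iff[OF f C01[OF w] C01[OF HC[OF z]], of "Suc k"] k(2) by simp
      also have "\<dots> = (h ^^ Suc k) (f z)" by (rule fH[OF z])
      also have "\<dots> < (h ^^ Suc k) ((h ^^ m) z)" using Hless[OF fC[OF z] HC[OF z], of "Suc k" m] m by blast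
      also have "\<dots> = (h ^^ Suc m) ((h ^^ k) z)" by (simp only: Hadd) (simp add: add.commute)
      also have "\<dots> \<le> (h ^^ Suc m) w" using Hle[OF HC[OF z] w, of "Suc m" k] k(1) by blast
      finally show ?thesis .
    next
      case False
      then have "w \<le> z" by simp
      obtain k where k: "(h ^^ k) w \<le> z" "z < (h ^^ Suc k) w" using fundamental[OF w z \<open>w \<le> z\<close>] by blast
      have "(h ^^ k) (f w) = f ((h ^^ k) w)" using fH[OF w] by simp
      also have "\<dots> \<le> f z" using Diff1_le_iff[OF f C01[OF HC[OF w]] C01[OF z], of k] k(1) by blast
      also have "\<dots> < (h ^^ m) z" by (rule m)
      also have "\<dots> < (h ^^ m) ((h ^^ Suc k) w)" using Hless[OF z HC[OF w], of m "Suc k"] k(2) by blast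
      also have "\<dots> = (h ^^ k) ((h ^^ Suc m) w)" by (simp only: Hadd) (simp add: add.commute)
      finally show ?thesis using Hless[OF fC[OF w] HC[OF w], of k "Suc m"] by blast
    qed
    \<comment> \<open>Any \<open>n\<close> with \<open>m + 1 \<le> 2 ^ n\<close> yields the
      contradiction, and \<open>n = m + 1\<close> is one.\<close>
    let ?n = "Suc m"
    have "(h ^^ (2 ^ ?n)) ((g ^^ ?n) z) = (g ^^ ?n) (h z)" using funpow_g_h[OF C01[OF z]] by metis
    also have "\<dots> \<le> (g ^^ ?n) (f z)"
      using Diff1_funpow_le_iff[OF g C01[OF hC[OF z]] C01[OF fC[OF z]]] fz by blast
    also have "\<dots> = f ((g ^^ ?n) z)" using Diff1_funpow_commute[OF f g fg C01[OF z]] by metis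
    also have "\<dots> < (h ^^ ?n) ((g ^^ ?n) z)" by (rule bound[OF GC[OF z]])
    also have "\<dots> \<le> (h ^^ (2 ^ ?n)) ((g ^^ ?n) z)"
      using less_exp[of ?n] by (intro Hmono GC z) simp
    finally show False by simp
  qed

  obtain m where m: "y < (h ^^ m) (g y)" using escape[OF gC[OF yC] yC] by blast
  \<comment> \<open>In units of \<open>h\<close>-steps from \<open>y\<close>, the map
    \<open>g\<close> sends position \<open>k\<close> to about \<open>2 * k\<close>, up to the offset
    \<open>m\<close> of \<open>g y\<close>. Once \<open>k > m\<close> this is progress towards
    \<open>b\<close>, so forward \<open>g\<close>-orbits stay where the linear estimates
    hold.\<close>
  have g_ge: "w \<le> g w" if w: "w \<in> C" "(h ^^ (m + 2)) y \<le> w" for w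
  proof -
    have "y \<le> w" using Hmono[OF yC, of 0 "m + 2"] w(2) by simp
    then obtain k where k: "(h ^^ k) y \<le> w" "w < (h ^^ Suc k) y" using fundamental[OF yC w(1)] by blast
    have km: "k > m"
    proof (rule ccontr)
      assume "\<not> k > m"
      then show False using Hmono[OF yC, of "Suc k" "m + 2"] k(2) w(2) by simp
    qed
    have "Suc k \<le> 2 * k - m" using km by linarith
    then have "w \<le> (h ^^ (2 * k - m)) y" using k(2) Hmono[OF yC, of "Suc k" "2 * k - m"] by linarith
    then have "(h ^^ m) w \<le> (h ^^ m) ((h ^^ (2 * k - m)) y)" using Hle[OF w(1) HC[OF yC]] by blast
    also have "\<dots> = (h ^^ (2 * k)) y" using km by (simp add: Hadd)
    also have "\<dots> \<le> (h ^^ (2 * k)) ((h ^^ m) (g y))"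
      using Hle[OF yC HC[OF gC[OF yC]], of "2 * k" m] m by simp
    also have "\<dots> = (h ^^ m) (g ((h ^^ k) y))"
      using g_funpow_h[OF C01[OF yC], of k] by (simp add: Hadd add.commute)
    also have "\<dots> \<le> (h ^^ m) (g w)"
      using Hle[OF gC[OF HC[OF yC]] gC[OF w(1)], of m k]
        Diff1_le_iff[OF g C01[OF HC[OF yC]] C01[OF w(1)], of k] k(1) by blast
    finally show ?thesis using Hle[OF w(1) gC[OF w(1)]] by blast
  qed

  obtain l \<delta> where "l > 0" "\<delta> > 0"
    and bounds: "\<And>x z. \<lbrakk>x \<in> {0..1}; z \<in> {0..1}; \<bar>x - b\<bar> < \<delta>; \<bar>z - b\<bar> < \<delta>; x \<le> z\<rbrakk> \<Longrightarrow>
      9/10 * l * (z - x) \<le> g z - g x \<and> 9/10 * (g z - g x) \<le> l * (z - x) \<and> 9/10 * (z - x) \<le> h z - h x"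
    using near_common_fixed_point[OF ab(2) ab_g(2) ab(4)] by blast
  \<comment> \<open>Past \<open>u\<close> both requirements hold: \<open>g\<close> does not move
    points to the left, and the distance to \<open>b\<close> is below
    \<open>\<delta>\<close>.\<close>
  define u where "u = max ((h ^^ (m + 2)) y) (b - \<delta> / 2)"
  have uC: "u \<in> C" using HC[OF yC, of "m + 2"] \<open>\<delta> > 0\<close> unfolding u_def C_def by auto
  define U where "U = {u..<b}"
  have UC: "x \<in> C" and near: "\<bar>x - b\<bar> < \<delta>" and g_up: "x \<le> g x" if "x \<in> U" for x
  proof -
    show "x \<in> C" using that uC by (auto simp: U_def C_def)
    then show "x \<le> g x" using that g_ge by (auto simp: U_def u_def)
    show "\<bar>x - b\<bar> < \<delta>" using that \<open>\<delta> > 0\<close> by (auto simp: U_def u_def)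
  qed
  have U_bounds: "9/10 * l * (z - x) \<le> g z - g x" "9/10 * (g z - g x) \<le> l * (z - x)"
      "9/10 * (z - x) \<le> h z - h x" if "x \<in> U" "z \<in> U" "x \<le> z" for x z
    using bounds[OF C01[OF UC[OF that(1)]] C01[OF UC[OF that(2)]] near[OF that(1)] near[OF that(2)] that(3)]
    by blast+
  have U_up: "z \<in> U" if "x \<in> U" "z \<in> C" "x \<le> z" for x z using that by (auto simp: U_def C_def)
  have gU: "g x \<in> U" if "x \<in> U" for x using U_up[OF that gC[OF UC[OF that]] g_up[OF that]] .
  have hU: "h x \<in> U" if "x \<in> U" for x
    using U_up[OF that hC[OF UC[OF that]]] pos[of x] UC[OF that] by (simp add: C_def)

  \<comment> \<open>Commuting with \<open>g\<close> and \<open>h\<close> makes this set invariant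
    under both maps, so the estimates for \<open>e\<close> can be iterated along orbits.\<close>
  define X where "X = {x \<in> U. x < f x}"
  have XU: "x \<in> U" and fU: "f x \<in> U" and fX: "x < f x" if "x \<in> X" for x
    using that U_up[of x "f x"] fC[OF UC, of x] by (auto simp: X_def)
  have gX: "g x \<in> X" if "x \<in> X" for x
    using Diff1_less_iff[OF g C01[OF UC[OF XU[OF that]]] C01[OF UC[OF fU[OF that]]]]
      fg[OF C01[OF UC[OF XU[OF that]]]] gU[OF XU[OF that]] fX[OF that] by (simp add: X_def)
  have hX: "h x \<in> X" if "x \<in> X" for x
    using Diff1_less_iff[OF h C01[OF UC[OF XU[OF that]]] C01[OF UC[OF fU[OF that]]]]
      fh[OF C01[OF UC[OF XU[OF that]]]] hU[OF XU[OF that]] fX[OF that] by (simp add: X_def)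
  have HX: "(h ^^ n) x \<in> X" if "x \<in> X" for x n by (induction n) (use that hX in auto)
  have GX: "(g ^^ n) x \<in> X" if "x \<in> X" for x n by (induction n) (use that gX in auto)
  define e where "e = (\<lambda>x. f x - x)"
  have e_g: "9/10 * l * e x \<le> e (g x)" and e_h: "9/10 * e x \<le> e (h x)" if "x \<in> X" for x
    using U_bounds(1,3)[OF XU[OF that] fU[OF that]] fX[OF that]
      fg[OF C01[OF UC[OF XU[OF that]]]] fh[OF C01[OF UC[OF XU[OF that]]]] by (simp_all add: e_def)

  define E where "E = (\<lambda>m x. \<Sum>j<m. e ((h ^^ j) x))"
  \<comment> \<open>The orbit points of \<open>g x\<close> with indices \<open>2 * j\<close> and
    \<open>2 * j + 1\<close> are \<open>g v\<close> and \<open>h (g v)\<close> for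
    \<open>v = (h ^^ j) x\<close>. Their displacements are at least \<open>9/10 * l * e v\<close>
    and \<open>81/100 * l * e v\<close>, which add up to the constant
    \<open>171/100\<close>.\<close>
  have E_double: "171/100 * l * E m x \<le> E (2 * m) (g x)" if x: "x \<in> X" for m x
  proof (induction m)
    case (Suc m)
    let ?v = "(h ^^ m) x"
    have v: "?v \<in> X" by (rule HX[OF x])
    have "(h ^^ (2 * m)) (g x) = g ?v"
      using g_funpow_h[OF C01[OF UC[OF XU[OF x]]], of m] by simp
    then have "E (2 * Suc m) (g x) = E (2 * m) (g x) + e (g ?v) + e (h (g ?v))"
      by (simp add: E_def)
    moreover have "171/100 * l * E (Suc m) x = 171/100 * l * E m x + 171/100 * (l * e ?v)"
      by (simp add: E_def algebra_simps)
    ultimately show ?case using Suc e_g[OF v] e_h[OF gX[OF v]] by simp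
  qed (simp add: E_def)
  have E_lower: "(171/100 * l) ^ n * e x \<le> E (2 ^ n) ((g ^^ n) x)" if x: "x \<in> X" for n x
  proof (induction n)
    case (Suc n)
    have "(171/100 * l) ^ Suc n * e x = 171/100 * l * ((171/100 * l) ^ n * e x)" by simp
    also have "\<dots> \<le> 171/100 * l * E (2 ^ n) ((g ^^ n) x)"
      using Suc \<open>l > 0\<close> by (intro mult_left_mono) auto
    also have "\<dots> \<le> E (2 ^ Suc n) ((g ^^ Suc n) x)" using E_double[OF GX[OF x]] by simp
    finally show ?case .
  qed (simp add: E_def)
  have E_upper: "E m x \<le> (h ^^ m) x - x" if x: "x \<in> C" for m x
  proof (induction m)
    case (Suc m)
    then show ?case using f_less_h[OF HC[OF x, of m]] by (simp add: E_def e_def)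
  qed (simp add: E_def)
  have g_upper: "(g ^^ n) (h x) - (g ^^ n) x \<le> (10/9 * l) ^ n * (h x - x)" if x: "x \<in> U" for n x
  proof (induction n)
    case (Suc n)
    have GU: "(g ^^ n) z \<in> U" if "z \<in> U" for z by (induction n) (use that gU in auto)
    have "(g ^^ n) x \<le> (g ^^ n) (h x)"
      using Diff1_funpow_le_iff[OF g C01[OF UC[OF x]] C01[OF hC[OF UC[OF x]]]] pos[of x] UC[OF x]
      by (simp add: C_def)
    then have "9/10 * ((g ^^ Suc n) (h x) - (g ^^ Suc n) x) \<le> l * ((g ^^ n) (h x) - (g ^^ n) x)"
      using U_bounds(2)[OF GU[OF x] GU[OF hU[OF x]]] by simp
    also have "\<dots> \<le> l * ((10/9 * l) ^ n * (h x - x))" using Suc \<open>l > 0\<close> by simp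
    finally show ?case by simp
  qed simp

  \<comment> \<open>The point \<open>y\<close> need not be near \<open>b\<close>. Pushing it there
    by a power of \<open>h\<close> keeps it moved to the right by \<open>f\<close>, which commutes
    with that power.\<close>
  obtain k where k: "u < (h ^^ k) y" using escape[OF yC uC] by blast
  define z where "z = (h ^^ k) y"
  have zC: "z \<in> C" unfolding z_def by (rule HC[OF yC])
  have "z \<in> X"
    using k zC fH[OF yC, of k] Hless[OF yC fC[OF yC], of k] fy
    by (auto simp: X_def U_def z_def C_def)
  \<comment> \<open>Comparing rates \<open>171/100 * l\<close> and \<open>10/9 * l\<close> leaves a
    gap: \<open>10/9 * 3/2 = 5/3\<close> is smaller than \<open>171/100\<close>.\<close>
  have "(3/2) ^ n * e z \<le> h z - z" for n
  proof -
    have "(10/9 * l) ^ n * ((3/2) ^ n * e z) = (5/3 * l) ^ n * e z"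
      by (simp add: power_mult_distrib[symmetric])
    also have "\<dots> \<le> (171/100 * l) ^ n * e z"
      using fX[OF \<open>z \<in> X\<close>] \<open>l > 0\<close> by (intro mult_right_mono power_mono) (auto simp: e_def)
    also have "\<dots> \<le> E (2 ^ n) ((g ^^ n) z)" by (rule E_lower[OF \<open>z \<in> X\<close>])
    also have "\<dots> \<le> (h ^^ (2 ^ n)) ((g ^^ n) z) - (g ^^ n) z" by (rule E_upper[OF GC[OF zC]])
    also have "\<dots> = (g ^^ n) (h z) - (g ^^ n) z" using funpow_g_h[OF C01[OF zC]] by simp
    also have "\<dots> \<le> (10/9 * l) ^ n * (h z - z)" by (rule g_upper[OF XU[OF \<open>z \<in> X\<close>]])
    finally show ?thesis using \<open>l > 0\<close> by (simp add: mult_le_cancel_left_pos)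
  qed
  moreover have "e z > 0" using fX[OF \<open>z \<in> X\<close>] by (simp add: e_def)
  ultimately have "(3/2) ^ n \<le> (h z - z) / e z" for n by (simp add: pos_le_divide_eq)
  moreover obtain n where "(h z - z) / e z < (3/2) ^ n" using real_arch_pow[of "3/2"] by auto
  ultimately show False by (meson not_less)
qed

text \<open>The one-sided bound on the component of \<open>x\<close> applies to \<open>f\<close> and
  to its inverse, and the two bounds together give equality.\<close>

lemma commuting_fixes_positive:
  assumes f: "f \<in> carrier Diff1"
    and fg: "\<And>x. x \<in> {0..1} \<Longrightarrow> f (g x) = g (f x)"
    and fh: "\<And>x. x \<in> {0..1} \<Longrightarrow> f (h x) = h (f x)"
    and x: "x \<in> {0..1}" "h x > x"
  shows "f x = x"
proof -
  obtain a b where ab: "a \<in> {0..1}" "b \<in> {0..1}" "h a = a" "h b = b" "a < x" "x < b"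
    and nofix: "\<And>z. a < z \<Longrightarrow> z < b \<Longrightarrow> h z \<noteq> z"
    using Diff1_component[OF h x(1)] x(2) by (metis less_irrefl)
  have pos: "h z > z" if "a < z" "z < b" for z
    by (rule Diff1_positive_on_component[OF h ab(1,2) nofix ab(5,6) x(2) that])
  have ab_g: "g a = a" "g b = b"
    using g_fixes_component[OF _ ab(1-4) nofix] ab(5,6) by force+
  \<comment> \<open>Since \<open>f\<close> commutes with \<open>h\<close>, the product satisfies the
    same relation with \<open>h\<close> and therefore fixes \<open>a\<close> and \<open>b\<close>.
    As \<open>g\<close> fixes them too, so does \<open>f\<close>.\<close>
  let ?p = "g \<otimes>\<^bsub>Diff1\<^esub> f"
  have p: "?p z = g (f z)" if "z \<in> {0..1}" for z by (rule Diff1_mult_apply[OF g f that])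
  interpret gf: BS12_pair ?p h
  proof
    show "?p \<in> carrier Diff1" using group_Diff1 g f by (meson group.is_monoid monoid.m_closed)
    fix z :: real assume "z \<in> {0..1}"
    then show "?p (h z) = h (h (?p z))"
      using fh rel Diff1_mem[OF f] Diff1_mem[OF h] by (simp only: p)
  qed (rule h)
  have "?p a = a" "?p b = b"
    using gf.g_fixes_component[OF _ ab(1-4) nofix] ab(5,6) by force+
  then have ab_f: "f a = a" "f b = b"
    using ab_g ab(1,2) Diff1_eq_iff[OF g] Diff1_mem[OF f] p by metis+
  let ?k = "inv\<^bsub>Diff1\<^esub> f"
  have k: "?k \<in> carrier Diff1" by (rule Diff1_inv_closed[OF f])
  have k_commute: "?k (s z) = s (?k z)"
    if "s \<in> carrier Diff1" "\<And>z. z \<in> {0..1} \<Longrightarrow> f (s z) = s (f z)" "z \<in> {0..1}" for s z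
    using that(2)[OF Diff1_mem[OF k that(3)]] Diff1_inv_apply[OF f] Diff1_mem[OF k that(3)] that(1,3)
      Diff1_mem[OF that(1)] by metis
  have k_fix: "?k a = a" "?k b = b" using Diff1_inv_apply(2)[OF f] ab(1,2) ab_f by metis+
  have "f x \<le> x"
    by (rule commuting_le_id_on_component[OF f fg fh ab(1-4) ab_f ab_g pos ab(5,6)])
  moreover have "?k x \<le> x"
    by (rule commuting_le_id_on_component[OF k k_commute[OF g fg] k_commute[OF h fh]
          ab(1-4) k_fix ab_g pos ab(5,6)])
  then have "x \<le> f x"
    using Diff1_le_iff[OF f Diff1_mem[OF k x(1)] x(1)] Diff1_inv_apply(1)[OF f x(1)] by simp
  ultimately show ?thesis by simp
qed

lemma commuting_fixes_supp:
  assumes f: "f \<in> carrier Diff1"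
    and fg: "\<And>x. x \<in> {0..1} \<Longrightarrow> f (g x) = g (f x)"
    and fh: "\<And>x. x \<in> {0..1} \<Longrightarrow> f (h x) = h (f x)"
    and x: "x \<in> {0..1}" "h x \<noteq> x"
  shows "f x = x"
proof (cases "h x > x")
  case True
  show ?thesis by (rule commuting_fixes_positive[OF f fg fh x(1) True])
next
  case False
  let ?k = "inv\<^bsub>Diff1\<^esub> h"
  interpret k: BS12_pair g ?k by (rule inv_h)
  have "h x < x" using False x(2) by simp
  then have kx: "?k x > x"
    using Diff1_less_iff[OF h x(1) Diff1_mem[OF k.h x(1)]] by (simp add: Diff1_inv_apply[OF h x(1)])
  have fk: "f (?k z) = ?k (f z)" if z: "z \<in> {0..1}" for z
    using fh[OF Diff1_mem[OF k.h z]] Diff1_inv_apply(1)[OF h z]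
      Diff1_inv_apply(2)[OF h Diff1_mem[OF f Diff1_mem[OF k.h z]]] by simp
  show ?thesis by (rule k.commuting_fixes_positive[OF f fg fk x(1) kx])
qed

end

section \<open>The group BS(1,2) and its generators\<close>

text \<open>The affine action of \<open>BS12\<close> on the real line, a model in which
  \<open>h\<close> is visibly nontrivial. With \<open>foldr\<close> the rightmost letter acts first,
  as in a composition.\<close>

fun affine_letter :: "bs_gen \<times> bool \<Rightarrow> real \<Rightarrow> real" where
  "affine_letter (Gen_g, e) x = (if e then x / 2 else 2 * x)"
| "affine_letter (Gen_h, e) x = (if e then x - 1 else x + 1)"

lemma affine_word_cong:
  "pres_eq BS12_relations u v \<Longrightarrow> foldr affine_letter u x = foldr affine_letter v x"
proof (induction arbitrary: x rule: pres_eq.induct)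
  case (cancel a e)
  show ?case by (cases a) auto
qed (auto simp: BS12_relations_def)

lemma BS12_gen_h_nontrivial: "BS12_gen Gen_h \<noteq> \<one>\<^bsub>BS12\<^esub>"
proof
  assume "BS12_gen Gen_h = \<one>\<^bsub>BS12\<^esub>"
  then have "pres_eq BS12_relations [(Gen_h, False)] []"
    by (simp add: BS12_gen_def BS12_def presented_group_def pres_class_eq_iff)
  from affine_word_cong[OF this, of 0] show False by simp
qed

lemma group_BS12: "group BS12"
  by (simp add: BS12_def group_presented_group)

lemma BS12_class_mult:
  "pres_class BS12_relations u \<otimes>\<^bsub>BS12\<^esub> pres_class BS12_relations v = pres_class BS12_relations (u @ v)"
  by (simp add: BS12_def presented_group_mult)

lemma BS12_class_closed: "pres_class BS12_relations u \<in> carrier BS12"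
  by (simp add: BS12_def presented_group_def)

lemma BS12_one: "\<one>\<^bsub>BS12\<^esub> = pres_class BS12_relations []"
  by (simp add: BS12_def presented_group_def)

lemma BS12_gen_closed: "BS12_gen a \<in> carrier BS12"
  unfolding BS12_gen_def by (rule BS12_class_closed)

lemma BS12_gen_inv: "inv\<^bsub>BS12\<^esub> (BS12_gen a) = pres_class BS12_relations [(a, True)]"
proof (rule group.inv_equality[OF group_BS12])
  have "pres_eq BS12_relations [(a, True), (a, False)] []"
    using pres_eq.cancel[of BS12_relations a True] by simp
  then show "pres_class BS12_relations [(a, True)] \<otimes>\<^bsub>BS12\<^esub> BS12_gen a = \<one>\<^bsub>BS12\<^esub>"
    by (simp add: BS12_gen_def BS12_class_mult BS12_one pres_class_eq_iff)
qed (simp_all add: BS12_gen_closed BS12_class_closed)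

text \<open>The defining relation multiplied by \<open>g\<close> on the right, which is the form
  required by \<open>BS12_pair\<close>.\<close>

lemma BS12_relator:
  "BS12_gen Gen_g \<otimes>\<^bsub>BS12\<^esub> BS12_gen Gen_h
    = BS12_gen Gen_h \<otimes>\<^bsub>BS12\<^esub> (BS12_gen Gen_h \<otimes>\<^bsub>BS12\<^esub> BS12_gen Gen_g)"
proof -
  interpret group BS12 by (rule group_BS12)
  let ?g = "BS12_gen Gen_g" and ?h = "BS12_gen Gen_h"
  note closed = BS12_gen_closed[of Gen_g] BS12_gen_closed[of Gen_h]
  have "pres_eq BS12_relations [(Gen_g, False), (Gen_h, False), (Gen_g, True)]
      [(Gen_h, False), (Gen_h, False)]"
    by (rule pres_eq.relation) (simp add: BS12_relations_def)
  then have "?g \<otimes>\<^bsub>BS12\<^esub> ?h \<otimes>\<^bsub>BS12\<^esub> inv\<^bsub>BS12\<^esub> ?g = ?h \<otimes>\<^bsub>BS12\<^esub> ?h"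
    unfolding BS12_gen_inv unfolding BS12_gen_def
    by (simp add: BS12_class_mult pres_class_eq_iff)
  then have "?g \<otimes>\<^bsub>BS12\<^esub> ?h \<otimes>\<^bsub>BS12\<^esub> inv\<^bsub>BS12\<^esub> ?g \<otimes>\<^bsub>BS12\<^esub> ?g = ?h \<otimes>\<^bsub>BS12\<^esub> ?h \<otimes>\<^bsub>BS12\<^esub> ?g" by simp
  then show ?thesis using closed by (simp add: m_assoc)
qed

text \<open>Serves to check properties of \<open>G\<close> on \<open>g\<close> and \<open>h\<close>
  only, as long as they define subgroups.\<close>

lemma BS12_generated:
  assumes K: "subgroup K BS12" and gens: "\<And>a. BS12_gen a \<in> K"
  shows "K = carrier BS12"
proof
  show "K \<subseteq> carrier BS12" by (rule subgroup.subset[OF K])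
  have letter: "pres_class BS12_relations [(a, e)] \<in> K" for a e
    using gens[of a] subgroup.m_inv_closed[OF K gens[of a]] BS12_gen_inv[of a]
    by (cases e) (simp_all add: BS12_gen_def)
  have "pres_class BS12_relations u \<in> K" for u
  proof (induction u)
    case Nil
    show ?case using subgroup.one_closed[OF K] by (simp add: BS12_one)
  next
    case (Cons p u)
    obtain a e where "p = (a, e)" by force
    then show ?case
      using subgroup.m_closed[OF K letter[of a e] Cons] by (simp add: BS12_class_mult)
  qed
  then show "carrier BS12 \<subseteq> K" by (auto simp: BS12_def presented_group_def)
qed

section \<open>Subgroups tested on generators, and commutation tested at points\<close>

lemma (in group_hom) subgroup_preimage:
  assumes K: "subgroup K H"
  shows "subgroup {x \<in> carrier G. h x \<in> K} G"
proof (rule G.subgroupI)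
  show "{x \<in> carrier G. h x \<in> K} \<noteq> {}"
    using subgroup.one_closed[OF K] G.one_closed hom_one by force
qed (auto simp: subgroup.m_inv_closed[OF K] subgroup.m_closed[OF K])

lemma (in group) subgroup_centralizer:
  assumes "A \<subseteq> carrier G"
  shows "subgroup (centralizer G A) G"
proof (rule subgroupI)
  fix a assume "a \<in> centralizer G A"
  then have a: "a \<in> carrier G" "\<And>k. k \<in> A \<Longrightarrow> a \<otimes> k = k \<otimes> a" by (auto simp: centralizer_def)
  have "inv a \<otimes> k = k \<otimes> inv a" if "k \<in> A" for k
  proof -
    have k: "k \<in> carrier G" using assms that by blast
    have "inv a \<otimes> k = inv a \<otimes> (k \<otimes> a) \<otimes> inv a" using a(1) k by (simp add: m_assoc)
    also have "\<dots> = inv a \<otimes> (a \<otimes> k) \<otimes> inv a" using a(2)[OF that] by simp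
    also have "\<dots> = k \<otimes> inv a" using a(1) k by (simp add: m_assoc[symmetric])
    finally show ?thesis .
  qed
  then show "inv a \<in> centralizer G A" using a(1) by (simp add: centralizer_def)
next
  fix a b assume "a \<in> centralizer G A" "b \<in> centralizer G A"
  then show "a \<otimes> b \<in> centralizer G A"
    using assms by (auto simp: centralizer_def) (metis m_assoc subsetD)
next
  have "\<one> \<in> centralizer G A" using assms by (auto simp: centralizer_def)
  then show "centralizer G A \<noteq> {}" by blast
qed (auto simp: centralizer_def)

lemma subgroup_stabilizer_Diff1:
  assumes x: "x \<in> {0..1}"
  shows "subgroup {f \<in> carrier Diff1. f x = x} Diff1"
proof (rule group.subgroupI[OF group_Diff1])
  show "{f \<in> carrier Diff1. f x = x} \<noteq> {}"
    using monoid.one_closed[OF group.is_monoid[OF group_Diff1]] Diff1_one_apply[OF x] by blast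
next
  fix f assume "f \<in> {f \<in> carrier Diff1. f x = x}"
  then show "inv\<^bsub>Diff1\<^esub> f \<in> {f \<in> carrier Diff1. f x = x}"
    using Diff1_inv_apply(2)[of f x] x by (auto simp: Diff1_inv_closed)
next
  fix f k assume "f \<in> {f \<in> carrier Diff1. f x = x}" "k \<in> {f \<in> carrier Diff1. f x = x}"
  then show "f \<otimes>\<^bsub>Diff1\<^esub> k \<in> {f \<in> carrier Diff1. f x = x}"
    using Diff1_mult_apply[of f k x] x monoid.m_closed[OF group.is_monoid[OF group_Diff1]] by auto
qed auto

lemma Diff1_commute_iff:
  assumes "f \<in> carrier Diff1" "k \<in> carrier Diff1"
  shows "f \<otimes>\<^bsub>Diff1\<^esub> k = k \<otimes>\<^bsub>Diff1\<^esub> f \<longleftrightarrow> (\<forall>x\<in>{0..1}. f (k x) = k (f x))"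
proof
  assume "f \<otimes>\<^bsub>Diff1\<^esub> k = k \<otimes>\<^bsub>Diff1\<^esub> f"
  then show "\<forall>x\<in>{0..1}. f (k x) = k (f x)"
    using Diff1_mult_apply[OF assms] Diff1_mult_apply[OF assms(2,1)] by metis
next
  assume "\<forall>x\<in>{0..1}. f (k x) = k (f x)"
  moreover have "f \<otimes>\<^bsub>Diff1\<^esub> k \<in> carrier Diff1" "k \<otimes>\<^bsub>Diff1\<^esub> f \<in> carrier Diff1"
    using assms by (simp_all add: monoid.m_closed[OF group.is_monoid[OF group_Diff1]])
  ultimately show "f \<otimes>\<^bsub>Diff1\<^esub> k = k \<otimes>\<^bsub>Diff1\<^esub> f"
    by (intro Diff1_eqI) (auto simp: Diff1_mult_apply assms)
qed

text \<open>Each map preserves its own support, so a point moved by one map has an image that the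
  other map fixes.\<close>

lemma supp_disjoint_commute:
  assumes f: "f \<in> carrier Diff1" and k: "k \<in> carrier Diff1" and disj: "supp f \<inter> supp k = {}"
  shows "f \<otimes>\<^bsub>Diff1\<^esub> k = k \<otimes>\<^bsub>Diff1\<^esub> f"
proof -
  have "f (k x) = k (f x)" if x: "x \<in> {0..1}" for x
  proof -
    have "k x = x \<or> f (k x) = k x"
      using disj Diff1_mem[OF k x] Diff1_eq_iff[OF k Diff1_mem[OF k x] x] by (auto simp: supp_def)
    moreover have "f x = x \<or> k (f x) = f x"
      using disj Diff1_mem[OF f x] Diff1_eq_iff[OF f Diff1_mem[OF f x] x] by (auto simp: supp_def)
    moreover have "f x = x \<or> k x = x" using disj x by (auto simp: supp_def)
    ultimately show ?thesis by metis
  qed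
  then show ?thesis using Diff1_commute_iff[OF f k] by blast
qed

lemma supp_eq_empty_iff: "f \<in> carrier Diff1 \<Longrightarrow> supp f = {} \<longleftrightarrow> f = \<one>\<^bsub>Diff1\<^esub>"
  using Diff1_eqI[of f "\<one>\<^bsub>Diff1\<^esub>"] monoid.one_closed[OF group.is_monoid[OF group_Diff1]]
  by (auto simp: supp_def Diff1_one_apply)

section \<open>The centralizer of \<open>G\<close>, by reduction to the two generators\<close>

theorem proposition1p8:
  fixes G :: "(real \<Rightarrow> real) set"
    and \<phi> :: "bs_gen word set \<Rightarrow> (real \<Rightarrow> real)"
    and g h :: "real \<Rightarrow> real"
  assumes "subgroup G Diff1"
    and "\<phi> \<in> iso BS12 (Diff1\<lparr>carrier := G\<rparr>)"
    and "g = \<phi> (BS12_gen Gen_g)"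
    and "h = \<phi> (BS12_gen Gen_h)"
  shows "centralizer Diff1 G
           = centralizer Diff1 {g} \<inter> Diff1_supported_in ({0..1} - supp h)
       \<and> (supp g \<subseteq> supp h \<longrightarrow>
           centralizer Diff1 G = Diff1_supported_in ({0..1} - supp h))
       \<and> ((\<nexists>x. x \<in> {0<..<1} \<and> (\<forall>k\<in>G. k x = x)) \<longrightarrow>
           centralizer Diff1 G = {\<one>\<^bsub>Diff1\<^esub>})"
proof -
  interpret D: group Diff1 by (rule group_Diff1)
  have GD: "G \<subseteq> carrier Diff1" by (rule subgroup.subset[OF assms(1)])
  have hom: "\<phi> \<in> hom BS12 Diff1" and img: "\<phi> ` carrier BS12 = G" and inj: "inj_on \<phi> (carrier BS12)"
    using assms(2) GD by (auto simp: iso_def hom_def bij_betw_def)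
  interpret \<phi>: group_hom BS12 Diff1 \<phi>
    using hom group_BS12 group_Diff1 by (simp add: group_hom_def group_hom_axioms_def)
  have gG: "g \<in> G" and hG: "h \<in> G" using img assms(3,4) BS12_gen_closed by blast+
  have g: "g \<in> carrier Diff1" and h: "h \<in> carrier Diff1" using gG hG GD by auto

  \<comment> \<open>The preimage of \<open>K\<close> under \<open>\<phi>\<close> is a subgroup
    containing both generators, hence all of \<open>BS12\<close>.\<close>
  have generated: "G \<subseteq> K" if K: "subgroup K Diff1" and "g \<in> K" "h \<in> K" for K
  proof -
    have "\<phi> (BS12_gen a) \<in> K" for a using that assms(3,4) by (cases a) auto
    then have "{u \<in> carrier BS12. \<phi> u \<in> K} = carrier BS12"
      by (intro BS12_generated \<phi>.subgroup_preimage[OF K]) (simp add: BS12_gen_closed)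
    then show ?thesis using img by blast
  qed

  have mult: "g \<otimes>\<^bsub>Diff1\<^esub> h = h \<otimes>\<^bsub>Diff1\<^esub> (h \<otimes>\<^bsub>Diff1\<^esub> g)"
    using arg_cong[OF BS12_relator, of \<phi>] assms(3,4) BS12_gen_closed by simp
  interpret BS12_pair g h
  proof
    fix x :: real assume x: "x \<in> {0..1}"
    have "g (h x) = (h \<otimes>\<^bsub>Diff1\<^esub> (h \<otimes>\<^bsub>Diff1\<^esub> g)) x"
      using mult Diff1_mult_apply[OF g h x] by metis
    also have "\<dots> = h (h (g x))"
      using x g h Diff1_mult_apply[OF h g x] Diff1_mult_apply[OF h D.m_closed[OF h g] x] by metis
    finally show "g (h x) = h (h (g x))" .
  qed (rule g h)+

  have fixes_supp: "f x = x" if f: "f \<in> centralizer Diff1 G" and x: "x \<in> supp h" for f x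
  proof (rule commuting_fixes_supp)
    show fD: "f \<in> carrier Diff1" using f by (simp add: centralizer_def)
    show "f (g z) = g (f z)" "f (h z) = h (f z)" if "z \<in> {0..1}" for z
      using f that gG hG Diff1_commute_iff[OF fD g] Diff1_commute_iff[OF fD h]
      by (auto simp: centralizer_def)
  qed (use x in \<open>auto simp: supp_def\<close>)

  have part1: "centralizer Diff1 G
      = centralizer Diff1 {g} \<inter> Diff1_supported_in ({0..1} - supp h)" (is "_ = ?R")
  proof
    show "centralizer Diff1 G \<subseteq> ?R"
      using fixes_supp gG by (auto simp: centralizer_def Diff1_supported_in_def supp_def)
    show "?R \<subseteq> centralizer Diff1 G"
    proof
      fix f assume f: "f \<in> ?R"
      then have fD: "f \<in> carrier Diff1" and fg: "f \<otimes>\<^bsub>Diff1\<^esub> g = g \<otimes>\<^bsub>Diff1\<^esub> f"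
        and "supp f \<inter> supp h = {}" by (auto simp: centralizer_def Diff1_supported_in_def)
      then have fh: "f \<otimes>\<^bsub>Diff1\<^esub> h = h \<otimes>\<^bsub>Diff1\<^esub> f" by (intro supp_disjoint_commute h)
      \<comment> \<open>The roles are exchanged: the elements commuting with \<open>f\<close> form a
        subgroup, and it contains \<open>g\<close> and \<open>h\<close>.\<close>
      have "G \<subseteq> centralizer Diff1 {f}"
        using fD fg fh g h by (intro generated D.subgroup_centralizer) (auto simp: centralizer_def)
      then show "f \<in> centralizer Diff1 G" using fD by (auto simp: centralizer_def)
    qed
  qed

  have part2: "centralizer Diff1 G = Diff1_supported_in ({0..1} - supp h)" if "supp g \<subseteq> supp h"
  proof -
    have "f \<otimes>\<^bsub>Diff1\<^esub> g = g \<otimes>\<^bsub>Diff1\<^esub> f" if "f \<in> Diff1_supported_in ({0..1} - supp h)" for f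
      using that \<open>supp g \<subseteq> supp h\<close>
      by (intro supp_disjoint_commute g) (auto simp: Diff1_supported_in_def)
    then have "Diff1_supported_in ({0..1} - supp h) \<subseteq> centralizer Diff1 {g}"
      by (auto simp: centralizer_def Diff1_supported_in_def)
    with part1 show ?thesis by blast
  qed

  have part3: "centralizer Diff1 G = {\<one>\<^bsub>Diff1\<^esub>}"
    if noglobal: "\<nexists>x. x \<in> {0<..<1} \<and> (\<forall>k\<in>G. k x = x)"
  proof -
    \<comment> \<open>Injectivity of \<open>\<phi>\<close> enters here: it makes the support of
      \<open>h\<close> nonempty, so that it has a component.\<close>
    have "h \<noteq> \<one>\<^bsub>Diff1\<^esub>"
      using BS12_gen_h_nontrivial inj_onD[OF inj] BS12_gen_closed[of Gen_h] assms(4)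
        \<phi>.hom_one \<phi>.G.one_closed by metis
    then obtain x where x: "x \<in> {0..1}" "h x \<noteq> x"
      using supp_eq_empty_iff[OF h] by (auto simp: supp_def)
    obtain a b where ab: "a \<in> {0..1}" "b \<in> {0..1}" "h a = a" "h b = b" "a < x" "x < b"
      and moved: "\<And>z. a < z \<Longrightarrow> z < b \<Longrightarrow> h z \<noteq> z"
      using Diff1_component[OF h x] by blast
    have "g a = a" "g b = b" using g_fixes_component[OF _ ab(1-4) moved] ab(5,6) by force+
    \<comment> \<open>Both generators fix the endpoints of the component, so these are global fixed
      points. Without interior ones the component is all of \<open>(0,1)\<close>.\<close>
    then have "\<forall>k\<in>G. k a = a" "\<forall>k\<in>G. k b = b"
      using generated[OF subgroup_stabilizer_Diff1[OF ab(1)]]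
        generated[OF subgroup_stabilizer_Diff1[OF ab(2)]] ab(3,4) g h by blast+
    then have "a \<notin> {0<..<1}" "b \<notin> {0<..<1}" using noglobal by blast+
    then have "a = 0" "b = 1" using ab by auto
    then have "{0<..<1} \<subseteq> supp h" using moved by (auto simp: supp_def)
    have "f = \<one>\<^bsub>Diff1\<^esub>" if f: "f \<in> centralizer Diff1 G" for f
    proof -
      have fD: "f \<in> carrier Diff1" using f by (simp add: centralizer_def)
      have "f z = z" if "z \<in> {0..1}" for z
      proof (cases "z = 0 \<or> z = 1")
        case True
        then show ?thesis using Diff1_endpoints[OF fD] by auto
      next
        case False
        then have "z \<in> {0<..<1}" using that by auto
        then show ?thesis using fixes_supp[OF f] \<open>{0<..<1} \<subseteq> supp h\<close> by blast
      qed
      then show ?thesis using supp_eq_empty_iff[OF fD] by (auto simp: supp_def)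
    qed
    moreover have "\<one>\<^bsub>Diff1\<^esub> \<in> centralizer Diff1 G"
      using GD by (auto simp: centralizer_def)
    ultimately show ?thesis by blast
  qed
  show ?thesis using part1 part2 part3 by blast
qed

end
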